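(* Let $H$ be a complex Hilbert space with $\dim H\geq 3$. Let $\phi:\mathcal{E}(H)\to\mathcal{E}(H)$ be a bijective map for which \[ E\leq F \Longleftrightarrow \phi(E)\leq\phi(F) \qquad (E,F\in\mathcal{E}(H)), \] and suppose that there are unit vectors $\varphi,\psi\in H$ such that \[ \langle \phi(E)\psi,\psi\rangle=\langle E\varphi,\varphi\rangle \qquad \text{for all } E\in\mathcal{E}(H). \] Then there exists an operator $U$ on $H$ which is either unitary or antiunitary such that \[ \phi(E)=UEU^* \qquad \text{for all } E\in\mathcal{E}(H) \] and $U\varphi=\psi$.
   Context: For a complex Hilbert space $H$ with inner product $\langle\cdot,\cdot\rangle$, $\mathcal{E}(H)$ denotes the set of all effects on $H$, i.e. the operator interval $[0,I]$ of all bounded self-adjoint operators $E$ on $H$ with $0\leq E\leq I$. The order $\leq$ is the usual order between bounded self-adjoint operators ($A\le B$ iff $B-A$ is positive semidefinite). An antiunitary operator is a conjugate-linear surjective isometry $U:H\to H$; for $U$ unitary or antiunitary, $U^*=U^{-1}$. *)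

theory Defs
  imports "HOL-Analysis.Analysis"
begin

text \<open>
  A complex inner product space is a real inner product space (which supplies norm, distance and
  topology) together with a complex scalar multiplication extending the real one and a sesquilinear
  form whose real part is the real inner product.  The form \<open>cinner\<close> is linear in its first
  argument and, by \<open>cinner_commute\<close>, conjugate-linear in the second.  Positive definiteness and
  \<open>norm x = sqrt (Re (cinner x x))\<close> follow from \<open>inner_eq_Re_cinner\<close> and the axioms of
  \<^class>\<open>real_inner\<close>.
\<close>

class complex_inner = real_inner +
  fixes scaleC :: "complex \<Rightarrow> 'a \<Rightarrow> 'a"  (infixr \<open>*\<^sub>C\<close> 75)
    and cinner :: "'a \<Rightarrow> 'a \<Rightarrow> complex"
  assumes scaleC_add_right: "a *\<^sub>C (x + y) = a *\<^sub>C x + a *\<^sub>C y"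
    and scaleC_add_left: "(a + b) *\<^sub>C x = a *\<^sub>C x + b *\<^sub>C x"
    and scaleC_scaleC: "a *\<^sub>C (b *\<^sub>C x) = (a * b) *\<^sub>C x"
    and scaleR_eq_scaleC: "r *\<^sub>R x = complex_of_real r *\<^sub>C x"
    and cinner_commute: "cinner x y = cnj (cinner y x)"
    and cinner_add_left: "cinner (x + y) z = cinner x z + cinner y z"
    and cinner_scaleC_left: "cinner (a *\<^sub>C x) y = a * cinner x y"
    and inner_eq_Re_cinner: "inner x y = Re (cinner x y)"

class complex_hilbert = complex_inner + complete_space

lemma cinner_self_eq_norm:
  fixes x :: "'a::complex_inner"
  shows "cinner x x = complex_of_real ((norm x)\<^sup>2)"
proof (rule complex_eqI)
  show "Re (cinner x x) = Re (complex_of_real ((norm x)\<^sup>2))"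
    by (simp add: power2_norm_eq_inner inner_eq_Re_cinner)
  have "Im (cinner x x) = Im (cnj (cinner x x))"
    using cinner_commute[of x x] by simp
  then show "Im (cinner x x) = Im (complex_of_real ((norm x)\<^sup>2))"
    by simp
qed

global_interpretation complex_vector: vector_space "scaleC :: complex \<Rightarrow> 'a \<Rightarrow> 'a::complex_inner"
proof unfold_locales
  show "1 *\<^sub>C x = x" for x :: 'a
    using scaleR_eq_scaleC[of 1 x] by simp
qed (simp_all add: scaleC_add_right scaleC_add_left scaleC_scaleC)

text \<open>The coordinate spaces are instances, so the classes are inhabited in every finite dimension.\<close>

instantiation complex :: complex_hilbert
begin
definition scaleC_complex :: "complex \<Rightarrow> complex \<Rightarrow> complex"
  where "scaleC_complex a x = a * x"
definition cinner_complex :: "complex \<Rightarrow> complex \<Rightarrow> complex"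
  where "cinner_complex x y = x * cnj y"
instance
  by standard
    (simp_all add: scaleC_complex_def cinner_complex_def algebra_simps scaleR_conv_of_real
      inner_complex_def)
end

instantiation vec :: (complex_hilbert, finite) complex_hilbert
begin
definition scaleC_vec :: "complex \<Rightarrow> 'a ^ 'b \<Rightarrow> 'a ^ 'b"
  where "scaleC_vec a x = (\<chi> i. a *\<^sub>C (x $ i))"
definition cinner_vec :: "'a ^ 'b \<Rightarrow> 'a ^ 'b \<Rightarrow> complex"
  where "cinner_vec x y = (\<Sum>i\<in>UNIV. cinner (x $ i) (y $ i))"
instance
proof
  fix x y :: "'a ^ 'b"
  show "cinner x y = cnj (cinner y x)"
    unfolding cinner_vec_def cnj_sum by (rule sum.cong[OF refl], rule cinner_commute)
qed (simp_all add: scaleC_vec_def cinner_vec_def vec_eq_iff scaleC_add_right scaleC_add_left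
      scaleC_scaleC scaleR_eq_scaleC cinner_add_left cinner_scaleC_left sum.distrib
      sum_distrib_left inner_vec_def inner_eq_Re_cinner)
end

text \<open>
  The library's dimension is 0 for spaces without a finite basis, hence the guard: a space that is
  not finitely spanned over the complex numbers has dimension at least \<open>n\<close> for every \<open>n\<close>.
\<close>

definition cdim_at_least :: "nat \<Rightarrow> 'a::complex_inner itself \<Rightarrow> bool"
  where "cdim_at_least n _ \<longleftrightarrow>
    ((\<exists>B :: 'a set. finite B \<and> complex_vector.span B = UNIV) \<longrightarrow>
      n \<le> complex_vector.dim (UNIV :: 'a set))"

definition bounded_clinear :: "('a::complex_inner \<Rightarrow> 'b::complex_inner) \<Rightarrow> bool"
  where "bounded_clinear A \<longleftrightarrow> bounded_linear A \<and> (\<forall>c x. A (c *\<^sub>C x) = c *\<^sub>C A x)"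

definition self_adjoint :: "('a::complex_inner \<Rightarrow> 'a) \<Rightarrow> bool"
  where "self_adjoint A \<longleftrightarrow> (\<forall>x y. cinner (A x) y = cinner x (A y))"

definition op_le :: "('a::complex_inner \<Rightarrow> 'a) \<Rightarrow> ('a \<Rightarrow> 'a) \<Rightarrow> bool"  (infix \<open>\<le>\<^sub>o\<^sub>p\<close> 50)
  where "A \<le>\<^sub>o\<^sub>p B \<longleftrightarrow> (\<forall>x. cinner (B x - A x) x \<in> \<real>\<^sub>\<ge>\<^sub>0)"

definition effects :: "('a::complex_inner \<Rightarrow> 'a) set"
  where "effects = {E. bounded_clinear E \<and> self_adjoint E \<and> (\<lambda>x. 0) \<le>\<^sub>o\<^sub>p E \<and> E \<le>\<^sub>o\<^sub>p id}"

text \<open>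
  A norm-preserving additive map is an isometry, so linearity reduces the isometry condition to
  preservation of the norm.  For both kinds of operators the adjoint is the inverse map \<open>inv U\<close>.
\<close>

definition unitary_op :: "('a::complex_inner \<Rightarrow> 'a) \<Rightarrow> bool"
  where "unitary_op U \<longleftrightarrow>
    (\<forall>x y. U (x + y) = U x + U y) \<and> (\<forall>c x. U (c *\<^sub>C x) = c *\<^sub>C U x) \<and>
    (\<forall>x. norm (U x) = norm x) \<and> surj U"

definition antiunitary_op :: "('a::complex_inner \<Rightarrow> 'a) \<Rightarrow> bool"
  where "antiunitary_op U \<longleftrightarrow>
    (\<forall>x y. U (x + y) = U x + U y) \<and> (\<forall>c x. U (c *\<^sub>C x) = cnj c *\<^sub>C U x) \<and>
    (\<forall>x. norm (U x) = norm x) \<and> surj U"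

end

theory Submission
  imports Defs
begin

text \<open>
  An effect \<open>E\<close> is determined by the rank-one effects below it, so the proof follows what
  \<open>\<phi>\<close> does to the operators \<open>rank1 y = \<langle>\<cdot>, y\<rangle> y\<close>.  An effect has
  rank at most one exactly when the effects below it form a chain; hence \<open>\<phi>\<close> permutes the
  rank-one effects, and also the rank-one projections, which are the maximal ones among them.

  The states enter through strength.  If \<open>\<phi>\<close> sends the projection onto the line of \<open>y\<close> to the one
  onto the line of \<open>y'\<close>, it sends multiples of the first to multiples of the second, and the
  equality of the states shows that the factor is kept whenever \<open>y\<close> is not orthogonal to \<open>\<xi>\<close>.  As
  these vectors are dense, \<open>\<phi>\<close> fixes every scalar effect \<open>c I\<close> (\<open>maps_scalar\<close>), and comparison
  with the scalars shows that the factor is kept for every \<open>y\<close> (\<open>maps_rank1_scaleR\<close>).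

  For a unit vector \<open>x\<close>, the operator with eigenvalue \<open>1\<close> at \<open>x\<close> and \<open>1/2\<close> on the complement of \<open>x\<close> is the least effect
  above both \<open>I/2\<close> and \<open>rank1 x\<close> (\<open>spiked_le_iff\<close>), so \<open>\<phi>\<close> maps operators of this kind to each
  other.  The largest multiple of \<open>rank1 y\<close> below such an operator depends on \<open>\<bar>\<langle>y, x\<rangle>\<bar>\<close> alone
  and determines it (\<open>rank1_le_spiked_iff\<close>).  So \<open>\<phi>\<close> preserves transition probabilities between
  lines, and Wigner's theorem (\<open>Wigner\<close>) provides a unitary or antiunitary \<open>U\<close> that induces \<open>\<phi>\<close>
  on the rank-one effects, and therefore on all effects.  Since the projection onto the line of \<open>\<xi>\<close>
  is the only rank-one projection having probability \<open>1\<close> in the state \<open>\<xi>\<close>, its image is the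
  projection onto the line of \<open>\<psi>\<close>, and the phase of \<open>U\<close> can be chosen so that \<open>U \<xi> = \<psi>\<close>.
\<close>

section \<open>Positive forms\<close>

lemma cinner_add_right: "cinner x (y + z) = cinner x y + cinner x z"
  by (metis cinner_add_left cinner_commute complex_cnj_add)

lemma cinner_scaleC_right: "cinner x (a *\<^sub>C y) = cnj a * cinner x y"
  by (metis cinner_scaleC_left cinner_commute complex_cnj_mult)

lemma cinner_scaleR_left: "cinner (r *\<^sub>R x) y = of_real r * cinner x y"
  by (simp add: scaleR_eq_scaleC cinner_scaleC_left)

lemma cinner_scaleR_right: "cinner x (r *\<^sub>R y) = of_real r * cinner x y"
  by (simp add: scaleR_eq_scaleC cinner_scaleC_right)

lemma cinner_minus_left: "cinner (- x) y = - cinner x y"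
  using cinner_scaleR_left[of "-1" x y] by simp

lemma cinner_minus_right: "cinner x (- y) = - cinner x y"
  using cinner_scaleR_right[of x "-1" y] by simp

lemma cinner_diff_left: "cinner (x - y) z = cinner x z - cinner y z"
  using cinner_add_left[of x "- y" z] by (simp add: cinner_minus_left)

lemma cinner_diff_right: "cinner x (y - z) = cinner x y - cinner x z"
  using cinner_add_right[of x y "- z"] by (simp add: cinner_minus_right)

lemma cinner_zero_left [simp]: "cinner 0 y = 0"
  using cinner_scaleR_left[of 0 0 y] by simp

lemma cinner_zero_right [simp]: "cinner x 0 = 0"
  using cinner_scaleR_right[of x 0 0] by simp

lemmas cinner_simps = cinner_add_left cinner_add_right cinner_scaleC_left cinner_scaleC_right
  cinner_scaleR_left cinner_scaleR_right cinner_minus_left cinner_minus_right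
  cinner_diff_left cinner_diff_right

lemma norm_scaleC: "norm (c *\<^sub>C x) = cmod c * norm x"
proof -
  have "complex_of_real ((norm (c *\<^sub>C x))\<^sup>2) = (c * cnj c) * cinner x x"
    unfolding cinner_self_eq_norm[symmetric] cinner_scaleC_left cinner_scaleC_right
    by (simp only: mult_ac)
  also have "\<dots> = complex_of_real ((cmod c * norm x)\<^sup>2)"
    by (simp only: complex_norm_square[symmetric] cinner_self_eq_norm of_real_mult power_mult_distrib)
  finally have "(norm (c *\<^sub>C x))\<^sup>2 = (cmod c * norm x)\<^sup>2"
    by (simp only: of_real_eq_iff)
  then show ?thesis
    by (simp add: power2_eq_iff_nonneg)
qed

lemma cmod_cinner_self: "cmod (cinner x x) = (norm x)\<^sup>2"
  by (simp only: cinner_self_eq_norm norm_of_real) simp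

lemma scaleC_one [simp]: "1 *\<^sub>C x = (x::'a::complex_inner)"
  using scaleR_eq_scaleC[of 1 x] by simp

lemma scaleC_zero_left [simp]: "0 *\<^sub>C x = (0::'a::complex_inner)"
  using scaleR_eq_scaleC[of 0 x] by simp

lemma scaleC_zero_right [simp]: "c *\<^sub>C 0 = (0::'a::complex_inner)"
  using norm_scaleC[of c 0] by simp

lemma scaleC_minus_right: "c *\<^sub>C (- x) = - (c *\<^sub>C (x::'a::complex_inner))"
  using scaleC_add_right[of c x "- x"] by (simp add: eq_neg_iff_add_eq_0 add.commute)

lemma scaleC_diff_right: "c *\<^sub>C (x - y) = c *\<^sub>C x - c *\<^sub>C (y::'a::complex_inner)"
  using scaleC_add_right[of c x "- y"] by (simp add: scaleC_minus_right)

lemma le_if_power4_le: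
  fixes a b :: real
  assumes "(a\<^sup>2)\<^sup>2 \<le> b\<^sup>2 * a\<^sup>2" "0 \<le> a" "0 \<le> b"
  shows "a \<le> b"
proof -
  have "a\<^sup>2 \<le> b * a"
    by (rule power2_le_imp_le) (use assms in \<open>simp_all add: power_mult_distrib\<close>)
  then show ?thesis
    using assms by (auto simp: power2_eq_square mult_le_cancel_right)
qed

lemma sgn_cnj_mult: "cnj (sgn b) * b = complex_of_real (cmod b)"
proof (cases "b = 0")
  case False
  have "cnj (sgn b) * b = (b * cnj b) / of_real (cmod b)"
    by (simp add: sgn_div_norm scaleR_conv_of_real divide_inverse)
  also have "\<dots> = of_real (cmod b)"
    using False by (simp only: complex_norm_square[symmetric]) (simp add: power2_eq_square)
  finally show ?thesis .
qed simp

text \<open>Rotating \<open>y\<close> by a phase makes the form real, after which this is the discriminant condition for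
  the nonnegative quadratic polynomial in \<open>t\<close> obtained at \<open>x + t y\<close>.\<close>

lemma positive_form_Cauchy_Schwarz:
  fixes A :: "'a::complex_inner \<Rightarrow> 'a"
  assumes add: "\<And>x y. A (x + y) = A x + A y" and hom: "\<And>c x. A (c *\<^sub>C x) = c *\<^sub>C A x"
    and sa: "self_adjoint A" and pos: "\<And>x. 0 \<le> inner (A x) x"
  shows "(cmod (cinner (A x) y))\<^sup>2 \<le> inner (A x) x * inner (A y) y"
proof -
  define b where "b = cinner (A x) y"
  define w where "w = sgn b *\<^sub>C y"
  have homR: "A (r *\<^sub>R x) = r *\<^sub>R A x" for r x
    by (simp add: scaleR_eq_scaleC hom)
  have xw: "inner (A x) w = cmod b"
    by (simp add: inner_eq_Re_cinner w_def cinner_simps b_def sgn_cnj_mult)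
  have wx: "inner (A w) x = cmod b"
    using sa xw unfolding self_adjoint_def by (metis inner_commute inner_eq_Re_cinner)
  have "inner (A w) w = Re (sgn b * cnj (sgn b) * cinner (A y) y)"
    by (simp add: w_def hom inner_eq_Re_cinner cinner_simps mult_ac)
  also have "\<dots> = (cmod (sgn b))\<^sup>2 * inner (A y) y"
    by (simp only: complex_norm_square[symmetric] inner_eq_Re_cinner Re_complex_of_real
        mult.commute times_complex.sel) simp
  also have "\<dots> \<le> inner (A y) y"
    using pos[of y] by (cases "b = 0") (auto simp: norm_sgn)
  finally have ww: "inner (A w) w \<le> inner (A y) y" .
  have quad: "0 \<le> inner (A x) x + 2 * t * cmod b + t\<^sup>2 * inner (A y) y" for t
  proof -
    have "inner (A (x + t *\<^sub>R w)) (x + t *\<^sub>R w) = inner (A x) x + 2 * t * cmod b + t\<^sup>2 * inner (A w) w"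
      by (simp add: add homR inner_simps xw wx power2_eq_square algebra_simps)
    with pos[of "x + t *\<^sub>R w"] mult_left_mono[OF ww, of "t\<^sup>2"] show ?thesis
      by simp
  qed
  show ?thesis
  proof (cases "inner (A y) y = 0")
    case True
    have "b = 0"
    proof (rule ccontr)
      assume "b \<noteq> 0"
      then show False
        using quad[of "- (inner (A x) x + 1) / (2 * cmod b)"] True by (simp add: field_simps)
    qed
    then show ?thesis
      using True by (simp add: b_def)
  next
    case False
    then have p: "inner (A y) y > 0"
      using pos[of y] by simp
    have "0 \<le> inner (A x) x - (cmod b)\<^sup>2 / inner (A y) y"
      using quad[of "- cmod b / inner (A y) y"] p by (simp add: power2_eq_square field_simps)
    then show ?thesis
      using p by (simp add: field_simps b_def)
  qed
qed

lemma cinner_Cauchy_Schwarz: "cmod (cinner x y) \<le> norm x * norm y"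
proof -
  have "(cmod (cinner x y))\<^sup>2 \<le> (norm x * norm y)\<^sup>2"
    using positive_form_Cauchy_Schwarz[of "\<lambda>x. x" x y]
    by (simp add: self_adjoint_def power2_norm_eq_inner power_mult_distrib)
  then show ?thesis
    by (rule power2_le_imp_le) simp
qed

text \<open>The equality case of the Cauchy--Schwarz inequality: vectors whose inner product is as large as
  possible differ by a phase only.\<close>

lemma phase_multiple_if_cmod_cinner_eq:
  assumes "norm a = norm b" "cmod (cinner a b) = (norm b)\<^sup>2"
  shows "\<exists>c. cmod c = 1 \<and> a = c *\<^sub>C b"
proof (cases "b = 0")
  case True
  with assms show ?thesis by (intro exI[of _ 1]) simp
next
  case False
  define c where "c = cinner a b / of_real ((norm b)\<^sup>2)"
  have c: "cmod c = 1"
    using assms False by (simp add: c_def norm_divide norm_power)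
  have ab: "cinner a b = c * of_real ((norm b)\<^sup>2)"
    using False by (simp add: c_def)
  have "cinner b a = cnj c * of_real ((norm b)\<^sup>2)"
    using ab by (metis cinner_commute complex_cnj_complex_of_real complex_cnj_mult)
  moreover have "c * cnj c = 1"
    using c by (simp add: complex_norm_square[symmetric])
  ultimately have "cinner (a - c *\<^sub>C b) (a - c *\<^sub>C b) = 0"
    by (simp add: cinner_simps ab cinner_self_eq_norm[of a] cinner_self_eq_norm[of b] assms(1)
        algebra_simps)
  then have "(norm (a - c *\<^sub>C b))\<^sup>2 = 0"
    by (metis cmod_cinner_self norm_zero)
  then have "a = c *\<^sub>C b"
    by simp
  with c show ?thesis by blast
qed

text \<open>By polarisation.  Stated for the real inner product, it applies to conjugates by antiunitary
  operators as well.\<close>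

lemma quadratic_form_eq_imp_eq:
  fixes A B :: "'a::real_inner \<Rightarrow> 'a"
  assumes "\<And>x y. A (x + y) = A x + A y" "\<And>x y. B (x + y) = B x + B y"
    and "\<And>x y. inner (A x) y = inner x (A y)" "\<And>x y. inner (B x) y = inner x (B y)"
    and eq: "\<And>x. inner (A x) x = inner (B x) x"
  shows "A = B"
proof
  fix x
  have "inner (A x - B x) y = 0" for y
    using eq[of "x + y"] eq[of x] eq[of y] assms(3)[of x y] assms(4)[of x y]
    by (simp add: assms(1,2) inner_simps) (simp add: inner_commute)
  then show "A x = B x"
    by (metis eq_iff_diff_eq_0 inner_eq_zero_iff)
qed

section \<open>Effects and their quadratic forms\<close>

lemma
  assumes "E \<in> effects"
  shows effect_add: "E (x + y) = E x + E y"
    and effect_scaleC: "E (c *\<^sub>C x) = c *\<^sub>C E x"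
    and effect_cinner: "cinner (E x) y = cinner x (E y)"
    and effect_inner: "inner (E x) y = inner x (E y)"
    and effect_form_nonneg: "0 \<le> inner (E x) x"
    and effect_form_le: "inner (E x) x \<le> (norm x)\<^sup>2"
    and effect_cinner_self: "cinner (E x) x = of_real (inner (E x) x)"
proof -
  have 1: "bounded_linear E" "\<And>c x. E (c *\<^sub>C x) = c *\<^sub>C E x" "self_adjoint E"
      "(\<lambda>x. 0) \<le>\<^sub>o\<^sub>p E" "E \<le>\<^sub>o\<^sub>p id"
    using assms by (auto simp: effects_def bounded_clinear_def)
  show "E (x + y) = E x + E y" "E (c *\<^sub>C x) = c *\<^sub>C E x"
    using 1 bounded_linear.linear linear_add by blast+
  show sa: "cinner (E x) y = cinner x (E y)" for x y
    using 1 by (simp add: self_adjoint_def)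
  then show "inner (E x) y = inner x (E y)"
    by (simp add: inner_eq_Re_cinner)
  show "0 \<le> inner (E x) x" "inner (E x) x \<le> (norm x)\<^sup>2"
    using 1(4,5) by (auto simp: op_le_def complex_nonneg_Reals_iff inner_eq_Re_cinner cinner_simps
        cinner_self_eq_norm dest!: spec[of _ x])
  show "cinner (E x) x = of_real (inner (E x) x)"
  proof (rule complex_eqI)
    have "cinner (E x) x = cnj (cinner (E x) x)"
      using sa[of x x] cinner_commute[of x "E x"] by simp
    then have "Im (cinner (E x) x) = - Im (cinner (E x) x)"
      by (metis cnj.simps(2))
    then show "Im (cinner (E x) x) = Im (of_real (inner (E x) x))"
      by simp
  qed (simp add: inner_eq_Re_cinner)
qed

text \<open>Boundedness comes for free: by the Cauchy--Schwarz inequality for the form of \<open>E\<close>,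
  \<open>\<parallel>E x\<parallel>\<^sup>4 \<le> \<parallel>x\<parallel>\<^sup>2 \<parallel>E x\<parallel>\<^sup>2\<close>.\<close>

lemma effectI:
  assumes add: "\<And>x y. E (x + y) = E x + E y" and hom: "\<And>c x. E (c *\<^sub>C x) = c *\<^sub>C E x"
    and sa: "\<And>x y. cinner (E x) y = cinner x (E y)"
    and pos: "\<And>x. 0 \<le> inner (E x) x" and le: "\<And>x. inner (E x) x \<le> (norm x)\<^sup>2"
  shows "E \<in> effects"
proof -
  have sa': "self_adjoint E"
    using sa by (simp add: self_adjoint_def)
  have bd: "norm (E x) \<le> norm x * 1" for x
  proof -
    have "((norm (E x))\<^sup>2)\<^sup>2 = (cmod (cinner (E x) (E x)))\<^sup>2"
      by (simp add: cmod_cinner_self)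
    also have "\<dots> \<le> inner (E x) x * inner (E (E x)) (E x)"
      by (rule positive_form_Cauchy_Schwarz[OF add hom sa' pos])
    also have "\<dots> \<le> (norm x)\<^sup>2 * (norm (E x))\<^sup>2"
      by (intro mult_mono le pos) simp
    finally have "norm (E x) \<le> norm x"
      by (rule le_if_power4_le) simp_all
    then show ?thesis
      by simp
  qed
  have "bounded_linear E"
    by (rule bounded_linear_intro[OF add _ bd]) (simp add: scaleR_eq_scaleC hom)
  moreover have "Im (cinner (E x) x) = 0" for x
  proof -
    have "cinner (E x) x = cnj (cinner (E x) x)"
      using sa[of x x] cinner_commute[of x "E x"] by simp
    then have "Im (cinner (E x) x) = - Im (cinner (E x) x)"
      by (metis cnj.simps(2))
    then show ?thesis by simp
  qed
  moreover have "Re (cinner (E x) x) \<le> (norm x)\<^sup>2" "0 \<le> Re (cinner (E x) x)" for x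
    using pos[of x] le[of x] by (simp_all add: inner_eq_Re_cinner)
  ultimately show ?thesis
    using hom sa' by (simp add: effects_def bounded_clinear_def op_le_def complex_nonneg_Reals_iff
        cinner_simps cinner_self_eq_norm)
qed

lemma effect_le_iff:
  assumes "E \<in> effects" "F \<in> effects"
  shows "E \<le>\<^sub>o\<^sub>p F \<longleftrightarrow> (\<forall>x. inner (E x) x \<le> inner (F x) x)"
  by (simp add: op_le_def cinner_simps assms[THEN effect_cinner_self] complex_nonneg_Reals_iff)

lemma effect_antisym:
  assumes "E \<in> effects" "F \<in> effects" "E \<le>\<^sub>o\<^sub>p F" "F \<le>\<^sub>o\<^sub>p E"
  shows "E = F"
  by (rule quadratic_form_eq_imp_eq)
    (use assms in \<open>auto simp: effect_le_iff effect_add effect_inner intro: antisym\<close>)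

lemma effect_form_Cauchy_Schwarz:
  assumes "E \<in> effects"
  shows "(cmod (cinner (E x) y))\<^sup>2 \<le> inner (E x) x * inner (E y) y"
  by (rule positive_form_Cauchy_Schwarz)
    (use assms in \<open>auto simp: effect_add effect_scaleC effect_form_nonneg self_adjoint_def
        effect_cinner\<close>)

lemma effect_complement:
  assumes "E \<in> effects"
  shows "(\<lambda>x. x - E x) \<in> effects"
  by (rule effectI) (use assms in \<open>simp_all add: effect_add effect_scaleC scaleC_diff_right cinner_simps
      effect_cinner inner_diff_left effect_form_nonneg effect_form_le flip: power2_norm_eq_inner\<close>)

lemma effect_vanishes_if_form_vanishes:
  assumes "E \<in> effects" "inner (E x) x = 0"
  shows "E x = 0"
  using effect_form_Cauchy_Schwarz[OF assms(1), of x "E x"] assms(2)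
  by (simp add: cinner_self_eq_norm)

lemma scalar_in_effects:
  assumes "0 \<le> r" "r \<le> 1"
  shows "(\<lambda>x. r *\<^sub>R x) \<in> effects"
proof (rule effectI)
  show "r *\<^sub>R (c *\<^sub>C x) = c *\<^sub>C (r *\<^sub>R x)" for c and x :: 'a
    by (simp add: scaleR_eq_scaleC scaleC_scaleC mult.commute)
qed (use assms in \<open>simp_all add: scaleR_add_right cinner_simps mult_left_le_one_le
      flip: power2_norm_eq_inner\<close>)

section \<open>Rank-one effects\<close>

definition rank1 :: "'a::complex_inner \<Rightarrow> 'a \<Rightarrow> 'a"
  where "rank1 y x = cinner x y *\<^sub>C y"

lemma rank1_form: "inner (rank1 y x) x = (cmod (cinner x y))\<^sup>2"
proof -
  have "inner (rank1 y x) x = Re (cinner x y * cnj (cinner x y))"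
    using cinner_commute[of y x] by (simp add: rank1_def inner_eq_Re_cinner cinner_simps)
  then show ?thesis
    by (simp only: complex_norm_square[symmetric] Re_complex_of_real)
qed

lemma rank1_in_effects_iff: "rank1 y \<in> effects \<longleftrightarrow> norm y \<le> 1"
proof
  assume "rank1 y \<in> effects"
  from effect_form_le[OF this, of y] show "norm y \<le> 1"
    using le_if_power4_le[of "norm y" 1] by (simp add: rank1_form cmod_cinner_self)
next
  assume y: "norm y \<le> 1"
  show "rank1 y \<in> effects"
  proof (rule effectI)
    fix x z
    have "cinner (rank1 y x) z = cinner x y * cinner y z"
      by (simp add: rank1_def cinner_simps)
    also have "\<dots> = cinner x (rank1 y z)"
      by (simp add: rank1_def cinner_simps cinner_commute[of y z])
    finally show "cinner (rank1 y x) z = cinner x (rank1 y z)" .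
    have "norm x * norm y \<le> norm x * 1"
      by (rule mult_left_mono[OF y]) simp
    then have "cmod (cinner x y) \<le> norm x"
      using cinner_Cauchy_Schwarz[of x y] by simp
    then show "inner (rank1 y x) x \<le> (norm x)\<^sup>2"
      by (simp add: rank1_form power_mono)
    show "0 \<le> inner (rank1 y x) x"
      by (simp add: rank1_form)
  qed (simp_all add: rank1_def cinner_simps scaleC_add_left scaleC_scaleC)
qed

lemma rank1_0: "rank1 0 = (\<lambda>x. 0)"
  by (simp add: rank1_def fun_eq_iff)

lemma rank1_phase:
  assumes "cmod c = 1"
  shows "rank1 (c *\<^sub>C y) = rank1 y"
proof
  fix x
  have "rank1 (c *\<^sub>C y) x = (c * cnj c * cinner x y) *\<^sub>C y"
    by (simp add: rank1_def cinner_simps scaleC_scaleC mult_ac)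
  also have "c * cnj c = 1"
    using assms by (simp only: complex_norm_square[symmetric]) simp
  finally show "rank1 (c *\<^sub>C y) x = rank1 y x"
    by (simp add: rank1_def)
qed

lemma rank1_le_iff:
  assumes "norm y \<le> 1" "E \<in> effects"
  shows "rank1 y \<le>\<^sub>o\<^sub>p E \<longleftrightarrow> (\<forall>x. (cmod (cinner x y))\<^sup>2 \<le> inner (E x) x)"
  using assms by (simp add: effect_le_iff rank1_in_effects_iff rank1_form)

lemma rank1_le_norm:
  assumes "norm y \<le> 1" "norm z \<le> 1" "rank1 y \<le>\<^sub>o\<^sub>p rank1 z"
  shows "norm y \<le> norm z"
proof -
  have "(cmod (cinner y y))\<^sup>2 \<le> (cmod (cinner y z))\<^sup>2"
    using assms by (simp add: rank1_le_iff rank1_in_effects_iff rank1_form)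
  then have "cmod (cinner y y) \<le> cmod (cinner y z)"
    by (rule power2_le_imp_le) simp
  also have "\<dots> \<le> norm y * norm z"
    by (rule cinner_Cauchy_Schwarz)
  finally have "norm y * norm y \<le> norm y * norm z"
    by (simp add: cmod_cinner_self power2_eq_square)
  then show ?thesis
    by (auto simp: mult_le_cancel_left)
qed

lemma rank1_scaleR_mono:
  assumes "norm y \<le> 1" "0 \<le> r" "r \<le> s" "s \<le> 1"
  shows "rank1 (r *\<^sub>R y) \<le>\<^sub>o\<^sub>p rank1 (s *\<^sub>R y)"
proof -
  have "norm (r *\<^sub>R y) \<le> 1" "norm (s *\<^sub>R y) \<le> 1"
    using assms by (auto intro: mult_le_one)
  then show ?thesis
    using assms by (auto simp: rank1_le_iff rank1_in_effects_iff rank1_form cinner_simps norm_mult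
        intro!: power_mono mult_right_mono)
qed

text \<open>The form of \<open>F\<close>, hence \<open>F\<close> itself, vanishes on the orthogonal complement of \<open>y\<close>;
  by self-adjointness its range then lies in the line of \<open>y\<close>.\<close>

lemma effect_below_rank1:
  assumes F: "F \<in> effects" and y: "norm y \<le> 1" and le: "F \<le>\<^sub>o\<^sub>p rank1 y"
  shows "\<exists>r. 0 \<le> r \<and> r \<le> 1 \<and> F = rank1 (r *\<^sub>R y)"
proof -
  have form: "inner (F x) x \<le> (cmod (cinner x y))\<^sup>2" for x
    using le F y by (simp add: effect_le_iff rank1_in_effects_iff rank1_form)
  have ker: "F x = 0" if "cinner x y = 0" for x
    using form[of x] effect_form_nonneg[OF F, of x] that
    by (intro effect_vanishes_if_form_vanishes[OF F]) simp
  show ?thesis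
  proof (cases "y = 0")
    case True
    then have "F = rank1 (0 *\<^sub>R y)"
      using ker by (simp add: rank1_0 fun_eq_iff)
    then show ?thesis by fastforce
  next
    case False
    define n where "n = (norm y)\<^sup>2"
    have n: "n > 0"
      using False by (simp add: n_def)
    have yy: "cinner y y = of_real n"
      by (simp add: n_def cinner_self_eq_norm)
    have dec: "F w = (cinner w y / of_real n) *\<^sub>C F y" for w
    proof -
      have "F (w - (cinner w y / of_real n) *\<^sub>C y) = 0"
        by (rule ker) (use n in \<open>simp add: cinner_simps yy\<close>)
      moreover have "w = (w - (cinner w y / of_real n) *\<^sub>C y) + (cinner w y / of_real n) *\<^sub>C y"
        by simp
      ultimately show ?thesis
        by (metis F add_0 effect_add effect_scaleC)
    qed
    define s where "s = inner (F y) y / n"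
    have "cinner w (F y - s *\<^sub>R y) = 0" for w
    proof -
      have "cinner w (F y) = cinner (F w) y"
        by (simp add: effect_cinner[OF F])
      also have "\<dots> = cinner w y / of_real n * cinner (F y) y"
        by (subst dec) (simp add: cinner_simps)
      finally show ?thesis
        using n by (simp add: cinner_simps effect_cinner_self[OF F] s_def)
    qed
    from this[of "F y - s *\<^sub>R y"] have Fy: "F y = s *\<^sub>R y"
      by (simp add: cinner_self_eq_norm)
    define r where "r = sqrt (s / n)"
    have "s \<ge> 0"
      using effect_form_nonneg[OF F] n by (simp add: s_def)
    then have r2: "r\<^sup>2 = s / n" and "r \<ge> 0"
      using n by (simp_all add: r_def)
    have "inner (F y) y \<le> n\<^sup>2"
      using form[of y] n by (simp add: yy)
    then have "s / n \<le> 1"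
      using n by (simp add: s_def field_simps power2_eq_square)
    then have "r \<le> 1"
      by (simp add: r_def)
    moreover have "F = rank1 (r *\<^sub>R y)"
    proof
      fix w
      have "F w = (cinner w y * of_real (s / n)) *\<^sub>C y"
        by (subst dec) (simp add: Fy scaleR_eq_scaleC scaleC_scaleC)
      then show "F w = rank1 (r *\<^sub>R y) w"
        by (simp add: rank1_def cinner_simps scaleR_eq_scaleC scaleC_scaleC r2[symmetric]
            power2_eq_square mult_ac)
    qed
    ultimately show ?thesis
      using \<open>r \<ge> 0\<close> by blast
  qed
qed

text \<open>Below every effect, and for every vector \<open>z\<close>, there is a rank-one effect with the same value
  at \<open>z\<close>: the one given by the vector \<open>E z / sqrt \<langle>E z, z\<rangle>\<close>, which is below \<open>E\<close> by the
  Cauchy--Schwarz inequality for the form of \<open>E\<close>.  An effect is therefore determined by the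
  rank-one effects below it.\<close>

lemma rank1_below_effect_touching:
  assumes E: "E \<in> effects"
  obtains v where "norm v \<le> 1" "rank1 v \<le>\<^sub>o\<^sub>p E" "(cmod (cinner z v))\<^sup>2 = inner (E z) z"
proof -
  define q where "q = inner (E z) z"
  have q: "q \<ge> 0"
    unfolding q_def by (rule effect_form_nonneg[OF E])
  \<comment> \<open>If \<open>q = 0\<close>, division by zero makes this the zero vector, as it should be.\<close>
  define v where "v = (1 / sqrt q) *\<^sub>R E z"
  have val: "(cmod (cinner x v))\<^sup>2 = (cmod (cinner (E x) z))\<^sup>2 / q" for x
    using q by (simp add: v_def cinner_simps norm_mult power_mult_distrib norm_divide power_divide
        effect_cinner[OF E])
  have below: "(cmod (cinner x v))\<^sup>2 \<le> inner (E x) x" for x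
  proof (cases "q = 0")
    case True
    then show ?thesis
      by (simp add: val effect_form_nonneg[OF E])
  next
    case False
    then show ?thesis
      using effect_form_Cauchy_Schwarz[OF E, of x z] q by (simp add: val q_def[symmetric] divide_le_eq)
  qed
  have "norm v \<le> 1"
    using order_trans[OF below[of v] effect_form_le[OF E, of v]]
    using le_if_power4_le[of "norm v" 1] by (simp add: cmod_cinner_self)
  moreover have "rank1 v \<le>\<^sub>o\<^sub>p E"
    using below \<open>norm v \<le> 1\<close> E by (simp add: rank1_le_iff)
  moreover have "(cmod (cinner z v))\<^sup>2 = inner (E z) z"
    using q by (simp add: val effect_cinner_self[OF E] q_def[symmetric])
      (simp add: power2_eq_square)
  ultimately show thesis
    by (rule that)
qed

definition chain_below :: "('a::complex_inner \<Rightarrow> 'a) \<Rightarrow> bool"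
  where "chain_below E \<longleftrightarrow>
    (\<forall>F\<in>effects. \<forall>G\<in>effects. F \<le>\<^sub>o\<^sub>p E \<longrightarrow> G \<le>\<^sub>o\<^sub>p E \<longrightarrow> F \<le>\<^sub>o\<^sub>p G \<or> G \<le>\<^sub>o\<^sub>p F)"

lemma chain_below_rank1:
  assumes "norm y \<le> 1"
  shows "chain_below (rank1 y)"
  unfolding chain_below_def
proof (intro ballI impI)
  fix F G
  assume *: "F \<in> effects" "G \<in> effects" "F \<le>\<^sub>o\<^sub>p rank1 y" "G \<le>\<^sub>o\<^sub>p rank1 y"
  obtain r s where "0 \<le> r" "r \<le> 1" "F = rank1 (r *\<^sub>R y)" "0 \<le> s" "s \<le> 1" "G = rank1 (s *\<^sub>R y)"
    using effect_below_rank1[OF *(1) assms *(3)] effect_below_rank1[OF *(2) assms *(4)] by blast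
  then show "F \<le>\<^sub>o\<^sub>p G \<or> G \<le>\<^sub>o\<^sub>p F"
    using rank1_scaleR_mono[OF assms] by (metis linear)
qed

text \<open>Fix \<open>z\<close> with \<open>\<langle>E z, z\<rangle> > 0\<close> and a rank-one effect touching \<open>E\<close> at \<open>z\<close>, and compare it with
  one touching \<open>E\<close> at another vector \<open>w\<close>.  The larger of the two touches \<open>E\<close> at both
  vectors, and if the second is larger, then the first is a multiple of it with the same nonzero
  value at \<open>z\<close>, so that they coincide.  Either way the first touches \<open>E\<close> at \<open>w\<close>.\<close>

lemma rank1_if_chain_below:
  assumes E: "E \<in> effects" and chain: "chain_below E"
  shows "\<exists>v. norm v \<le> 1 \<and> E = rank1 v"
proof (cases "\<exists>z. inner (E z) z \<noteq> 0")
  case False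
  then have "E = rank1 0"
    using effect_vanishes_if_form_vanishes[OF E] by (auto simp: rank1_0)
  then show ?thesis by (metis norm_zero zero_le_one)
next
  case True
  then obtain z where z: "inner (E z) z > 0"
    using effect_form_nonneg[OF E] by (metis order_le_less)
  obtain v where v: "norm v \<le> 1" "rank1 v \<le>\<^sub>o\<^sub>p E" "(cmod (cinner z v))\<^sup>2 = inner (E z) z"
    using rank1_below_effect_touching[OF E] by metis
  have "inner (E w) w \<le> (cmod (cinner w v))\<^sup>2" for w
  proof -
    obtain u where u: "norm u \<le> 1" "rank1 u \<le>\<^sub>o\<^sub>p E" "(cmod (cinner w u))\<^sup>2 = inner (E w) w"
      using rank1_below_effect_touching[OF E] by metis
    have "rank1 u \<le>\<^sub>o\<^sub>p rank1 v \<or> rank1 v \<le>\<^sub>o\<^sub>p rank1 u"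
      using chain u v by (simp add: chain_below_def rank1_in_effects_iff)
    then show ?thesis
    proof
      assume "rank1 u \<le>\<^sub>o\<^sub>p rank1 v"
      then show ?thesis
        using u v by (metis rank1_le_iff rank1_in_effects_iff rank1_form)
    next
      assume "rank1 v \<le>\<^sub>o\<^sub>p rank1 u"
      then obtain r where r: "0 \<le> r" "r \<le> 1" "rank1 v = rank1 (r *\<^sub>R u)"
        using effect_below_rank1 u v rank1_in_effects_iff by blast
      have "inner (E z) z = r\<^sup>2 * (cmod (cinner z u))\<^sup>2"
        using v(3) r(3) rank1_form[of v z] rank1_form[of "r *\<^sub>R u" z]
        by (simp add: cinner_simps norm_mult power_mult_distrib)
      also have "\<dots> \<le> r\<^sup>2 * inner (E z) z"
        using u E by (intro mult_left_mono) (auto simp: rank1_le_iff)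
      finally have "1 \<le> r\<^sup>2"
        using z by simp
      then have "r = 1"
        using r(1,2) power2_le_imp_le[of 1 r] by simp
      then show ?thesis
        using r(3) u(3) rank1_form[of v w] rank1_form[of u w] by simp
    qed
  qed
  then have "E \<le>\<^sub>o\<^sub>p rank1 v"
    using E v by (simp add: effect_le_iff rank1_in_effects_iff rank1_form)
  then have "E = rank1 v"
    using E v by (intro effect_antisym) (simp_all add: rank1_in_effects_iff)
  then show ?thesis
    using v by blast
qed


lemma rank1_le_scalar_iff:
  assumes "norm y = 1" "0 \<le> r" "r \<le> 1" "0 \<le> c" "c \<le> 1"
  shows "rank1 (r *\<^sub>R y) \<le>\<^sub>o\<^sub>p (\<lambda>x. c *\<^sub>R x) \<longleftrightarrow> r\<^sup>2 \<le> c"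
proof -
  have "rank1 (r *\<^sub>R y) \<le>\<^sub>o\<^sub>p (\<lambda>x. c *\<^sub>R x) \<longleftrightarrow> (\<forall>x. r\<^sup>2 * (cmod (cinner x y))\<^sup>2 \<le> c * (norm x)\<^sup>2)"
    using assms by (simp add: rank1_le_iff scalar_in_effects cinner_simps norm_mult power_mult_distrib
        power2_norm_eq_inner)
  also have "\<dots> \<longleftrightarrow> r\<^sup>2 \<le> c"
  proof
    assume "\<forall>x. r\<^sup>2 * (cmod (cinner x y))\<^sup>2 \<le> c * (norm x)\<^sup>2"
    from this[rule_format, of y] show "r\<^sup>2 \<le> c"
      using assms by (simp add: cmod_cinner_self)
  next
    assume "r\<^sup>2 \<le> c"
    moreover have "(cmod (cinner x y))\<^sup>2 \<le> (norm x)\<^sup>2" for x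
      using cinner_Cauchy_Schwarz[of x y] assms by (intro power_mono) auto
    ultimately show "\<forall>x. r\<^sup>2 * (cmod (cinner x y))\<^sup>2 \<le> c * (norm x)\<^sup>2"
      using assms by (auto intro!: mult_mono)
  qed
  finally show ?thesis .
qed

lemma rank1_eq_imp_phase:
  assumes "norm a = 1" "norm b = 1" "rank1 a = rank1 b"
  shows "\<exists>c. cmod c = 1 \<and> a = c *\<^sub>C b"
proof -
  have "(cmod (cinner a b))\<^sup>2 = 1"
    using assms rank1_form[of a a] rank1_form[of b a] by (simp add: cmod_cinner_self)
  then have "cmod (cinner a b) = 1"
    by (simp add: power2_eq_1_iff) (use norm_ge_zero[of "cinner a b"] in linarith)
  then show ?thesis
    using assms by (intro phase_multiple_if_cmod_cinner_eq) simp_all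
qed

section \<open>Spiked effects\<close>

text \<open>The eigenvalues are \<open>1\<close> at \<open>x\<close> and \<open>1/2\<close> on its orthogonal complement; any other value
  strictly between \<open>0\<close> and \<open>1\<close> would serve as well as \<open>1/2\<close>.\<close>

definition spiked :: "'a::complex_inner \<Rightarrow> 'a \<Rightarrow> 'a"
  where "spiked x w = (1/2) *\<^sub>R (w + rank1 x w)"

lemma spiked_form: "inner (spiked x w) w = ((norm w)\<^sup>2 + (cmod (cinner w x))\<^sup>2) / 2"
  by (simp add: spiked_def inner_simps rank1_form power2_norm_eq_inner)

lemma spiked_in_effects:
  assumes "norm x = 1"
  shows "spiked x \<in> effects"
proof (rule effectI)
  have R: "rank1 x \<in> effects"
    using assms by (simp add: rank1_in_effects_iff)
  fix y z c
  show "spiked x (y + z) = spiked x y + spiked x z"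
    by (simp add: spiked_def effect_add[OF R] scaleR_add_right)
  show "spiked x (c *\<^sub>C y) = c *\<^sub>C spiked x y"
    by (simp add: spiked_def effect_scaleC[OF R] scaleR_eq_scaleC scaleC_scaleC mult.commute
        flip: scaleC_add_right)
  show "cinner (spiked x y) z = cinner y (spiked x z)"
    by (simp add: spiked_def cinner_simps effect_cinner[OF R])
  show "0 \<le> inner (spiked x y) y"
    by (simp add: spiked_form)
  show "inner (spiked x y) y \<le> (norm y)\<^sup>2"
    using effect_form_le[OF R, of y] by (simp add: spiked_form rank1_form)
qed

text \<open>An effect \<open>F\<close> above the projection \<open>rank1 x\<close> fixes \<open>x\<close>, since the form of \<open>I - F\<close> vanishes
  there.  It therefore splits along \<open>x\<close> and its orthogonal complement, and \<open>spiked x\<close>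
  is the least effect above both \<open>rank1 x\<close> and \<open>I / 2\<close>.  Two effects rarely have a least common
  upper bound; here one exists because \<open>rank1 x\<close> reaches the upper bound \<open>I\<close> of all effects.\<close>

lemma spiked_le_iff:
  assumes x: "norm x = 1" and F: "F \<in> effects"
  shows "spiked x \<le>\<^sub>o\<^sub>p F \<longleftrightarrow> (\<lambda>w. (1/2) *\<^sub>R w) \<le>\<^sub>o\<^sub>p F \<and> rank1 x \<le>\<^sub>o\<^sub>p F"
proof -
  have half: "(\<lambda>w::'a. (1/2) *\<^sub>R w) \<in> effects"
    by (rule scalar_in_effects) simp_all
  have cs: "(cmod (cinner w x))\<^sup>2 \<le> (norm w)\<^sup>2" for w
    using cinner_Cauchy_Schwarz[of w x] x by (intro power_mono) auto
  show ?thesis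
  proof
    assume "spiked x \<le>\<^sub>o\<^sub>p F"
    then have *: "((norm w)\<^sup>2 + (cmod (cinner w x))\<^sup>2) / 2 \<le> inner (F w) w" for w
      using F x by (simp add: effect_le_iff spiked_in_effects spiked_form)
    have "(norm w)\<^sup>2 / 2 \<le> inner (F w) w" "(cmod (cinner w x))\<^sup>2 \<le> inner (F w) w" for w
      using *[of w] cs[of w] zero_le_power2[of "cmod (cinner w x)"] by argo+
    then show "(\<lambda>w. (1/2) *\<^sub>R w) \<le>\<^sub>o\<^sub>p F \<and> rank1 x \<le>\<^sub>o\<^sub>p F"
      using F x half by (simp add: effect_le_iff rank1_in_effects_iff rank1_form power2_norm_eq_inner)
  next
    assume "(\<lambda>w. (1/2) *\<^sub>R w) \<le>\<^sub>o\<^sub>p F \<and> rank1 x \<le>\<^sub>o\<^sub>p F"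
    then have ge_half: "(norm w)\<^sup>2 / 2 \<le> inner (F w) w"
      and ge_rank1: "(cmod (cinner w x))\<^sup>2 \<le> inner (F w) w" for w
      using F x half by (simp_all add: effect_le_iff rank1_in_effects_iff rank1_form power2_norm_eq_inner)
    have "inner (F x) x = 1"
      using ge_rank1[of x] effect_form_le[OF F, of x] x by (simp add: cmod_cinner_self)
    then have "x - F x = 0"
      using x by (intro effect_vanishes_if_form_vanishes[OF effect_complement[OF F]])
        (simp add: inner_simps flip: power2_norm_eq_inner)
    then have Fx: "F x = x" by simp
    have xx: "cinner x x = 1"
      using x by (simp add: cinner_self_eq_norm)
    have "((norm w)\<^sup>2 + (cmod (cinner w x))\<^sup>2) / 2 \<le> inner (F w) w" for w
    proof -
      define a where "a = cinner w x"
      define v where "v = w - a *\<^sub>C x"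
      have w: "w = a *\<^sub>C x + v" by (simp add: v_def)
      have vx: "cinner v x = 0"
        by (simp add: v_def a_def cinner_simps xx)
      then have xv: "cinner x v = 0"
        using cinner_commute[of x v] by simp
      have Fvx: "cinner (F v) x = 0"
        by (simp add: effect_cinner[OF F] Fx vx)
      have aa: "Re (a * cnj a) = (cmod a)\<^sup>2"
        by (simp only: complex_norm_square[symmetric] Re_complex_of_real)
      have "cinner (F w) w = a * cnj a + cinner (F v) v"
        by (simp add: w effect_add[OF F] effect_scaleC[OF F] Fx cinner_simps xx vx xv Fvx)
      then have Fw: "inner (F w) w = (cmod a)\<^sup>2 + inner (F v) v"
        by (simp only: inner_eq_Re_cinner aa plus_complex.sel)
      have "cinner w w = a * cnj a + cinner v v"
        by (simp add: w cinner_simps xx vx xv)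
      then have "Re (cinner w w) = (cmod a)\<^sup>2 + Re (cinner v v)"
        by (simp only: aa plus_complex.sel)
      then have ww: "(norm w)\<^sup>2 = (cmod a)\<^sup>2 + (norm v)\<^sup>2"
        by (simp add: cinner_self_eq_norm del: of_real_power)
      show ?thesis
        using ge_half[of v] unfolding Fw ww a_def[symmetric] by simp
    qed
    then show "spiked x \<le>\<^sub>o\<^sub>p F"
      using F x by (simp add: effect_le_iff spiked_in_effects spiked_form)
  qed
qed

text \<open>For an invertible effect \<open>E\<close> and a unit vector \<open>y\<close>, the Cauchy--Schwarz inequality for the
  form of \<open>E\<close> at the preimage \<open>z\<close> of \<open>y\<close> shows that \<open>t (rank1 y)\<close> is below \<open>E\<close> if and only if
  \<open>t \<langle>z, y\<rangle> \<le> 1\<close>.  For \<open>E = spiked x\<close>, this preimage is \<open>z = 2 y - \<langle>y, x\<rangle> x\<close>.\<close>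

lemma rank1_le_spiked_iff:
  assumes x: "norm x = 1" and y: "norm y = 1" and r: "0 \<le> r" "r \<le> 1"
  shows "rank1 (r *\<^sub>R y) \<le>\<^sub>o\<^sub>p spiked x \<longleftrightarrow> r\<^sup>2 * (2 - (cmod (cinner y x))\<^sup>2) \<le> 1"
proof -
  define a where "a = cinner y x"
  define z where "z = 2 *\<^sub>R y - a *\<^sub>C x"
  define q where "q = 2 - (cmod a)\<^sup>2"
  have xx: "cinner x x = 1" and yy: "cinner y y = 1"
    using x y by (simp_all add: cinner_self_eq_norm)
  have xy: "cinner x y = cnj a"
    by (simp add: a_def flip: cinner_commute)
  have S: "spiked x \<in> effects"
    by (rule spiked_in_effects[OF x])
  have "cinner z x = a"
    by (simp add: z_def cinner_simps xx a_def[symmetric])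
  then have Sz: "spiked x z = y"
    by (simp add: spiked_def rank1_def z_def)
  have zy: "cinner z y = of_real q"
    using complex_norm_square[of a] by (simp add: z_def cinner_simps yy xy q_def)
  have "cmod a \<le> 1"
    using cinner_Cauchy_Schwarz[of y x] x y by (simp add: a_def)
  then have "(cmod a)\<^sup>2 \<le> 1"
    by (simp add: power_le_one)
  then have q: "q > 0"
    by (simp add: q_def)
  have formz: "inner (spiked x z) z = q"
    using zy by (simp add: Sz inner_eq_Re_cinner cinner_commute[of y z])
  have "norm (r *\<^sub>R y) \<le> 1"
    using y r by simp
  then have "rank1 (r *\<^sub>R y) \<le>\<^sub>o\<^sub>p spiked x \<longleftrightarrow>
      (\<forall>w. r\<^sup>2 * (cmod (cinner w y))\<^sup>2 \<le> inner (spiked x w) w)"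
    using S by (simp add: rank1_le_iff cinner_simps norm_mult power_mult_distrib)
  also have "\<dots> \<longleftrightarrow> r\<^sup>2 * q \<le> 1"
  proof
    assume "\<forall>w. r\<^sup>2 * (cmod (cinner w y))\<^sup>2 \<le> inner (spiked x w) w"
    from this[rule_format, of z] have "(r\<^sup>2 * q) * q \<le> 1 * q"
      by (simp add: zy formz power2_eq_square mult.assoc)
    then show "r\<^sup>2 * q \<le> 1"
      using q by (simp only: mult_le_cancel_right)
  next
    assume rq: "r\<^sup>2 * q \<le> 1"
    show "\<forall>w. r\<^sup>2 * (cmod (cinner w y))\<^sup>2 \<le> inner (spiked x w) w"
    proof
      fix w
      have "(cmod (cinner w y))\<^sup>2 \<le> inner (spiked x w) w * q"
        using effect_form_Cauchy_Schwarz[OF S, of w z] by (simp add: effect_cinner[OF S] Sz formz[unfolded Sz])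
      then have "r\<^sup>2 * (cmod (cinner w y))\<^sup>2 \<le> r\<^sup>2 * (inner (spiked x w) w * q)"
        by (rule mult_left_mono) simp
      also have "\<dots> = inner (spiked x w) w * (r\<^sup>2 * q)"
        by simp
      also have "\<dots> \<le> inner (spiked x w) w * 1"
        by (rule mult_left_mono[OF rq effect_form_nonneg[OF S]])
      finally show "r\<^sup>2 * (cmod (cinner w y))\<^sup>2 \<le> inner (spiked x w) w"
        by simp
    qed
  qed
  finally show ?thesis
    by (simp add: q_def a_def)
qed

section \<open>Order automorphisms matching two vector states\<close>

lemma quadratic_nonneg_at_0:
  fixes a b c :: real
  assumes "\<And>t. t > 0 \<Longrightarrow> 0 \<le> a + b * t + c * t\<^sup>2"
  shows "0 \<le> a"
proof (rule tendsto_lowerbound)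
  have "((\<lambda>t. a + b * t + c * t\<^sup>2) \<longlongrightarrow> a + b * 0 + c * 0\<^sup>2) (at_right 0)"
    by (intro tendsto_intros)
  then show "((\<lambda>t. a + b * t + c * t\<^sup>2) \<longlongrightarrow> a) (at_right 0)"
    by simp
  show "\<forall>\<^sub>F t in at_right 0. 0 \<le> a + b * t + c * t\<^sup>2"
    using assms by (auto simp: eventually_at_right_field intro: exI[of _ 1])
qed simp

locale state_order_automorphism =
  fixes \<phi> :: "('a::complex_inner \<Rightarrow> 'a) \<Rightarrow> ('a \<Rightarrow> 'a)" and \<xi> \<psi> :: 'a
  assumes bij: "bij_betw \<phi> effects effects"
    and order: "\<And>E F. E \<in> effects \<Longrightarrow> F \<in> effects \<Longrightarrow> E \<le>\<^sub>o\<^sub>p F \<longleftrightarrow> \<phi> E \<le>\<^sub>o\<^sub>p \<phi> F"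
    and unit: "norm \<xi> = 1" "norm \<psi> = 1"
    and state: "\<And>E. E \<in> effects \<Longrightarrow> inner (\<phi> E \<psi>) \<psi> = inner (E \<xi>) \<xi>"
begin

lemma maps_effects: "E \<in> effects \<Longrightarrow> \<phi> E \<in> effects"
  using bij by (auto simp: bij_betw_def)

lemma inverse_effects: "E \<in> effects \<Longrightarrow> inv_into effects \<phi> E \<in> effects"
  using bij by (auto simp: bij_betw_def inv_into_into)

lemma map_inverse: "E \<in> effects \<Longrightarrow> \<phi> (inv_into effects \<phi> E) = E"
  using bij by (auto simp: bij_betw_def f_inv_into_f)

text \<open>This symmetry, which exchanges the two states, turns every inequality proved for \<open>\<phi>\<close> into the
  reverse inequality as well.\<close>

lemma inverse: "state_order_automorphism (inv_into effects \<phi>) \<psi> \<xi>"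
proof
  show "bij_betw (inv_into effects \<phi>) effects effects"
    by (rule bij_betw_inv_into[OF bij])
  show "E \<le>\<^sub>o\<^sub>p F \<longleftrightarrow> inv_into effects \<phi> E \<le>\<^sub>o\<^sub>p inv_into effects \<phi> F"
    if "E \<in> effects" "F \<in> effects" for E F
    using order[OF that[THEN inverse_effects]] that by (simp add: map_inverse)
  show "inner (inv_into effects \<phi> E \<xi>) \<xi> = inner (E \<psi>) \<psi>" if "E \<in> effects" for E
    using state[OF inverse_effects[OF that]] that by (simp add: map_inverse)
qed (rule unit)+

lemma chain_below_image:
  assumes E: "E \<in> effects" and chain: "chain_below E"
  shows "chain_below (\<phi> E)"
  unfolding chain_below_def
proof (intro ballI impI)
  fix F G
  assume FG: "F \<in> effects" "G \<in> effects" "F \<le>\<^sub>o\<^sub>p \<phi> E" "G \<le>\<^sub>o\<^sub>p \<phi> E"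
  obtain F' G' where F': "F' \<in> effects" "F = \<phi> F'" and G': "G' \<in> effects" "G = \<phi> G'"
    using FG inverse_effects map_inverse by metis
  with FG E have "F' \<le>\<^sub>o\<^sub>p E" "G' \<le>\<^sub>o\<^sub>p E"
    using order by simp_all
  then have "F' \<le>\<^sub>o\<^sub>p G' \<or> G' \<le>\<^sub>o\<^sub>p F'"
    using chain F' G' by (simp add: chain_below_def)
  then show "F \<le>\<^sub>o\<^sub>p G \<or> G \<le>\<^sub>o\<^sub>p F"
    using F' G' order by simp
qed

lemma maps_rank1:
  assumes "norm y \<le> 1"
  shows "\<exists>y'. norm y' \<le> 1 \<and> \<phi> (rank1 y) = rank1 y'"
  using assms by (intro rank1_if_chain_below maps_effects chain_below_image chain_below_rank1)
    (simp_all add: rank1_in_effects_iff)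

lemma rank1_preimage:
  assumes "norm y \<le> 1"
  shows "\<exists>x. norm x \<le> 1 \<and> \<phi> (rank1 x) = rank1 y"
proof -
  interpret inv: state_order_automorphism "inv_into effects \<phi>" \<psi> \<xi>
    by (rule inverse)
  show ?thesis
    using inv.maps_rank1[OF assms] map_inverse[of "rank1 y"] assms
    by (metis rank1_in_effects_iff)
qed

text \<open>Rank-one projections are the maximal elements among the rank-one effects, a property that \<open>\<phi>\<close>
  and its inverse respect.\<close>

lemma maps_rank1_unit:
  assumes y: "norm y = 1"
  shows "\<exists>y'. norm y' = 1 \<and> \<phi> (rank1 y) = rank1 y'"
proof -
  obtain y' where y': "norm y' \<le> 1" "\<phi> (rank1 y) = rank1 y'"
    using maps_rank1[of y] y by auto
  \<comment> \<open>A unit vector with \<open>y'\<close> on its line; when \<open>y' = 0\<close>, which the argument rules out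
    only indirectly, any unit vector is one, and \<open>\<psi>\<close> is at hand.\<close>
  define u where "u = (if y' = 0 then \<psi> else sgn y')"
  have u: "norm u = 1" "norm y' *\<^sub>R u = y'"
    using unit by (auto simp: u_def norm_sgn sgn_div_norm)
  obtain w where w: "norm w \<le> 1" "\<phi> (rank1 w) = rank1 u"
    using rank1_preimage[of u] u by auto
  have "rank1 y' \<le>\<^sub>o\<^sub>p rank1 u"
    using rank1_scaleR_mono[of u "norm y'" 1] u y' by simp
  then have le: "rank1 y \<le>\<^sub>o\<^sub>p rank1 w"
    using order[of "rank1 y" "rank1 w"] y y' w by (simp add: rank1_in_effects_iff)
  obtain r where r: "0 \<le> r" "r \<le> 1" "rank1 y = rank1 (r *\<^sub>R w)"
    using effect_below_rank1[OF _ w(1) le] y by (auto simp: rank1_in_effects_iff)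
  have rw: "r * norm w \<le> 1"
    using r w by (simp add: mult_le_one)
  have "rank1 y \<le>\<^sub>o\<^sub>p rank1 (r *\<^sub>R w)"
    using y by (subst r(3)[symmetric]) (simp add: effect_le_iff rank1_in_effects_iff)
  then have "1 \<le> r * norm w"
    using rank1_le_norm[of y "r *\<^sub>R w"] y r rw by simp
  moreover have "r * norm w \<le> r * 1"
    using w r by (intro mult_left_mono) auto
  ultimately have "r = 1"
    using r by simp
  then show ?thesis
    using r(3) w(2) u(1) by auto
qed

lemma rank1_unit_preimage:
  assumes "norm y = 1"
  shows "\<exists>x. norm x = 1 \<and> \<phi> (rank1 x) = rank1 y"
proof -
  interpret inv: state_order_automorphism "inv_into effects \<phi>" \<psi> \<xi>
    by (rule inverse)
  show ?thesis
    using inv.maps_rank1_unit[OF assms] map_inverse[of "rank1 y"] assms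
    by (metis rank1_in_effects_iff order_refl)
qed

lemma rank1_state:
  assumes "norm y \<le> 1" "\<phi> (rank1 y) = rank1 y'"
  shows "cmod (cinner \<psi> y') = cmod (cinner \<xi> y)"
  using state[of "rank1 y"] assms
  by (simp add: rank1_in_effects_iff rank1_form power2_eq_iff_nonneg)

lemma maps_scaled_rank1:
  assumes y: "norm y = 1" and y': "norm y' = 1" "\<phi> (rank1 y) = rank1 y'" and r: "0 \<le> r" "r \<le> 1"
  shows "\<exists>s. 0 \<le> s \<and> s \<le> 1 \<and> \<phi> (rank1 (r *\<^sub>R y)) = rank1 (s *\<^sub>R y')"
proof -
  have eff: "rank1 (r *\<^sub>R y) \<in> effects" "rank1 y \<in> effects"
    using y r by (simp_all add: rank1_in_effects_iff)
  have "\<phi> (rank1 (r *\<^sub>R y)) \<le>\<^sub>o\<^sub>p rank1 y'"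
    using rank1_scaleR_mono[of y r 1] y y' r order[OF eff] by simp
  then show ?thesis
    using y' eff by (intro effect_below_rank1 maps_effects) simp_all
qed

lemma maps_scaled_rank1_generic:
  assumes y: "norm y = 1" and y': "norm y' = 1" "\<phi> (rank1 y) = rank1 y'" and r: "0 \<le> r" "r \<le> 1"
    and ne: "cinner \<xi> y \<noteq> 0"
  shows "\<phi> (rank1 (r *\<^sub>R y)) = rank1 (r *\<^sub>R y')"
proof -
  obtain s where s: "0 \<le> s" "s \<le> 1" "\<phi> (rank1 (r *\<^sub>R y)) = rank1 (s *\<^sub>R y')"
    using maps_scaled_rank1[OF y y' r] by blast
  have "s * cmod (cinner \<psi> y') = r * cmod (cinner \<xi> y)"
    using rank1_state[OF _ s(3)] y r s by (simp add: cinner_simps norm_mult)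
  moreover have "cmod (cinner \<psi> y') = cmod (cinner \<xi> y)"
    using rank1_state[OF _ y'(2)] y by simp
  ultimately have "s = r"
    using ne by simp
  with s show ?thesis by simp
qed

text \<open>The rank-one effects \<open>c (rank1 y')\<close> with \<open>y'\<close> a unit vector not orthogonal to \<open>\<psi>\<close> are the images of
  rank-one effects of the same strength \<open>c\<close>, which lie below \<open>c I\<close>.  So the bound holds at all such
  vectors, and they are dense.\<close>

lemma scalar_le_image:
  assumes c: "0 \<le> c" "c \<le> 1"
  shows "(\<lambda>x. c *\<^sub>R x) \<le>\<^sub>o\<^sub>p \<phi> (\<lambda>x. c *\<^sub>R x)"
proof -
  define F where "F = \<phi> (\<lambda>x. c *\<^sub>R x)"
  have F: "F \<in> effects"
    unfolding F_def by (rule maps_effects[OF scalar_in_effects[OF c]])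
  have homR: "F (r *\<^sub>R x) = r *\<^sub>R F x" for r x
    by (simp add: scaleR_eq_scaleC effect_scaleC[OF F])
  have unit_case: "c \<le> inner (F y') y'" if y': "norm y' = 1" "cinner \<psi> y' \<noteq> 0" for y'
  proof -
    obtain y where y: "norm y = 1" "\<phi> (rank1 y) = rank1 y'"
      using rank1_unit_preimage y' by blast
    then have "cinner \<xi> y \<noteq> 0"
      using rank1_state[of y y'] y' by auto
    moreover have r: "0 \<le> sqrt c" "sqrt c \<le> 1"
      using c by simp_all
    ultimately have im: "\<phi> (rank1 (sqrt c *\<^sub>R y)) = rank1 (sqrt c *\<^sub>R y')"
      using y y' by (intro maps_scaled_rank1_generic) simp_all
    have "rank1 (sqrt c *\<^sub>R y) \<le>\<^sub>o\<^sub>p (\<lambda>x. c *\<^sub>R x)"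
      using rank1_le_scalar_iff[OF y(1) r c] c by simp
    then have "rank1 (sqrt c *\<^sub>R y') \<le>\<^sub>o\<^sub>p F"
      using order[of "rank1 (sqrt c *\<^sub>R y)" "\<lambda>x. c *\<^sub>R x"] y r c
      by (simp add: rank1_in_effects_iff scalar_in_effects im F_def)
    then have "(cmod (cinner y' (sqrt c *\<^sub>R y')))\<^sup>2 \<le> inner (F y') y'"
      using rank1_le_iff[of "sqrt c *\<^sub>R y'" F] F r y' by simp
    then show ?thesis
      using y' c by (simp add: cinner_simps norm_mult cmod_cinner_self)
  qed
  have dense_case: "0 \<le> inner (F x) x - c * inner x x" if x: "cinner \<psi> x \<noteq> 0" for x
  proof -
    have "x \<noteq> 0"
      using x by auto
    then have "c \<le> inner (F (sgn x)) (sgn x)"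
      using x by (intro unit_case) (simp_all add: norm_sgn sgn_div_norm cinner_simps)
    also have "\<dots> = inner (F x) x / inner x x"
      using \<open>x \<noteq> 0\<close> by (simp add: sgn_div_norm homR power2_eq_square divide_inverse
          flip: power2_norm_eq_inner)
    finally show ?thesis
      using \<open>x \<noteq> 0\<close> by (simp add: le_divide_eq)
  qed
  have "0 \<le> inner (F x) x - c * inner x x" for x
  proof (cases "cinner \<psi> x = 0")
    case True
    show ?thesis
    proof (rule quadratic_nonneg_at_0)
      fix t :: real
      assume "t > 0"
      have "cinner \<psi> (x + t *\<^sub>R \<psi>) = of_real t"
        using True unit by (simp add: cinner_simps cinner_self_eq_norm)
      then have "0 \<le> inner (F (x + t *\<^sub>R \<psi>)) (x + t *\<^sub>R \<psi>) - c * inner (x + t *\<^sub>R \<psi>) (x + t *\<^sub>R \<psi>)"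
        using \<open>t > 0\<close> by (intro dense_case) simp
      then show "0 \<le> (inner (F x) x - c * inner x x)
          + (inner (F x) \<psi> + inner (F \<psi>) x - c * (2 * inner x \<psi>)) * t
          + (inner (F \<psi>) \<psi> - c * inner \<psi> \<psi>) * t\<^sup>2"
        by (simp add: effect_add[OF F] homR inner_simps inner_commute[of \<psi> x] power2_eq_square
            algebra_simps)
    qed
  qed (rule dense_case)
  then show ?thesis
    using F c by (simp add: effect_le_iff scalar_in_effects F_def[symmetric])
qed

lemma maps_scalar:
  assumes c: "0 \<le> c" "c \<le> 1"
  shows "\<phi> (\<lambda>x. c *\<^sub>R x) = (\<lambda>x. c *\<^sub>R x)"
proof (rule effect_antisym)
  interpret inv: state_order_automorphism "inv_into effects \<phi>" \<psi> \<xi>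
    by (rule inverse)
  have S: "(\<lambda>x::'a. c *\<^sub>R x) \<in> effects"
    by (rule scalar_in_effects[OF c])
  then show "\<phi> (\<lambda>x. c *\<^sub>R x) \<le>\<^sub>o\<^sub>p (\<lambda>x. c *\<^sub>R x)"
    using order[OF S inverse_effects[OF S]] inv.scalar_le_image[OF c] by (simp add: map_inverse)
qed (simp_all add: maps_effects scalar_in_effects c scalar_le_image)

text \<open>Comparison with scalars, which are fixed, extends the preservation of strength to the rank-one
  projections about which the states give no information.\<close>

lemma maps_rank1_scaleR:
  assumes y: "norm y = 1" and y': "norm y' = 1" "\<phi> (rank1 y) = rank1 y'" and r: "0 \<le> r" "r \<le> 1"
  shows "\<phi> (rank1 (r *\<^sub>R y)) = rank1 (r *\<^sub>R y')"
proof -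
  obtain s where s: "0 \<le> s" "s \<le> 1" "\<phi> (rank1 (r *\<^sub>R y)) = rank1 (s *\<^sub>R y')"
    using maps_scaled_rank1[OF y y' r] by blast
  have iff: "r\<^sup>2 \<le> c \<longleftrightarrow> s\<^sup>2 \<le> c" if c: "0 \<le> c" "c \<le> 1" for c
  proof -
    have "r\<^sup>2 \<le> c \<longleftrightarrow> rank1 (r *\<^sub>R y) \<le>\<^sub>o\<^sub>p (\<lambda>x. c *\<^sub>R x)"
      using rank1_le_scalar_iff[OF y r c] by simp
    also have "\<dots> \<longleftrightarrow> rank1 (s *\<^sub>R y') \<le>\<^sub>o\<^sub>p (\<lambda>x. c *\<^sub>R x)"
      using order[of "rank1 (r *\<^sub>R y)" "\<lambda>x. c *\<^sub>R x"] y r c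
      by (simp add: rank1_in_effects_iff scalar_in_effects maps_scalar s)
    also have "\<dots> \<longleftrightarrow> s\<^sup>2 \<le> c"
      by (rule rank1_le_scalar_iff[OF y'(1) s(1,2) c])
    finally show ?thesis .
  qed
  have "r\<^sup>2 = s\<^sup>2"
    using iff[of "r\<^sup>2"] iff[of "s\<^sup>2"] r s by (simp add: power_le_one)
  then have "r = s"
    using r s by (simp add: power2_eq_iff_nonneg)
  with s show ?thesis by simp
qed

text \<open>The two effects are the least upper bounds of \<open>I/2\<close> and \<open>rank1 x\<close>, and of the images
  \<open>I/2\<close> and \<open>rank1 x'\<close>.\<close>

lemma maps_spiked:
  assumes x: "norm x = 1" and x': "norm x' = 1" "\<phi> (rank1 x) = rank1 x'"
  shows "\<phi> (spiked x) = spiked x'"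
proof -
  have half: "\<phi> (\<lambda>w. (1/2) *\<^sub>R w) = (\<lambda>w. (1/2) *\<^sub>R w)" "(\<lambda>w::'a. (1/2) *\<^sub>R w) \<in> effects"
    by (simp_all add: maps_scalar scalar_in_effects)
  have S: "spiked x \<in> effects" "spiked x' \<in> effects" "rank1 x \<in> effects"
    using x x' by (simp_all add: spiked_in_effects rank1_in_effects_iff)
  have iff: "spiked x \<le>\<^sub>o\<^sub>p F \<longleftrightarrow> spiked x' \<le>\<^sub>o\<^sub>p \<phi> F" if F: "F \<in> effects" for F
    using spiked_le_iff[OF x F] spiked_le_iff[OF x'(1) maps_effects[OF F]]
      order[OF half(2) F] order[OF S(3) F] by (simp add: half x')
  show ?thesis
  proof (rule effect_antisym)
    show "spiked x' \<le>\<^sub>o\<^sub>p \<phi> (spiked x)"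
      using iff[OF S(1)] S(1) by (simp add: effect_le_iff)
    have "spiked x \<le>\<^sub>o\<^sub>p inv_into effects \<phi> (spiked x')"
      using iff[OF inverse_effects[OF S(2)]] S(2) by (simp add: map_inverse effect_le_iff)
    then show "\<phi> (spiked x) \<le>\<^sub>o\<^sub>p spiked x'"
      using order[OF S(1) inverse_effects[OF S(2)]] S(2) by (simp add: map_inverse)
  qed (simp_all add: S maps_effects)
qed

text \<open>The multiples of \<open>rank1 y\<close> below \<open>spiked x\<close> are matched with those of \<open>rank1 y'\<close> below
  \<open>spiked x'\<close>, and each of these families reveals the corresponding transition probability.\<close>

lemma preserves_transition_probability:
  assumes x: "norm x = 1" "norm x' = 1" "\<phi> (rank1 x) = rank1 x'"
    and y: "norm y = 1" "norm y' = 1" "\<phi> (rank1 y) = rank1 y'"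
  shows "cmod (cinner y' x') = cmod (cinner y x)"
proof -
  define p where "p = 2 - (cmod (cinner y x))\<^sup>2"
  define p' where "p' = 2 - (cmod (cinner y' x'))\<^sup>2"
  have "cmod (cinner y x) \<le> 1" "cmod (cinner y' x') \<le> 1"
    using cinner_Cauchy_Schwarz[of y x] cinner_Cauchy_Schwarz[of y' x'] x y by simp_all
  then have p: "p \<ge> 1" "p' \<ge> 1"
    by (simp_all add: p_def p'_def power_le_one)
  have iff: "r\<^sup>2 * p \<le> 1 \<longleftrightarrow> r\<^sup>2 * p' \<le> 1" if r: "0 \<le> r" "r \<le> 1" for r
  proof -
    have "r\<^sup>2 * p \<le> 1 \<longleftrightarrow> rank1 (r *\<^sub>R y) \<le>\<^sub>o\<^sub>p spiked x"
      using rank1_le_spiked_iff[OF x(1) y(1) r] by (simp add: p_def)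
    also have "\<dots> \<longleftrightarrow> rank1 (r *\<^sub>R y') \<le>\<^sub>o\<^sub>p spiked x'"
      using order[of "rank1 (r *\<^sub>R y)" "spiked x"] x y r
      by (simp add: rank1_in_effects_iff spiked_in_effects maps_spiked maps_rank1_scaleR)
    also have "\<dots> \<longleftrightarrow> r\<^sup>2 * p' \<le> 1"
      using rank1_le_spiked_iff[OF x(2) y(2) r] by (simp add: p'_def)
    finally show ?thesis .
  qed
  \<comment> \<open>The largest admissible factors are \<open>1 / sqrt p\<close> and \<open>1 / sqrt p'\<close>.\<close>
  have "p' \<le> p" "p \<le> p'"
    using iff[of "1 / sqrt p"] iff[of "1 / sqrt p'"] p by (simp_all add: power_divide)
  then have "(cmod (cinner y x))\<^sup>2 = (cmod (cinner y' x'))\<^sup>2"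
    by (simp add: p_def p'_def)
  then show ?thesis
    by (simp add: power2_eq_iff_nonneg)
qed

end


section \<open>Maps preserving transition probabilities\<close>

text \<open>The squared norm of the difference of the two sides is a combination of inner products of
  values of \<open>V\<close>, hence equal to the same combination for their arguments, which is zero.\<close>

lemma real_linear_if_inner_preserving:
  fixes V :: "'a::real_inner \<Rightarrow> 'b::real_inner"
  assumes V: "\<And>x y. x \<in> S \<Longrightarrow> y \<in> S \<Longrightarrow> inner (V x) (V y) = inner x y"
    and S: "x \<in> S" "y \<in> S" "a *\<^sub>R x + b *\<^sub>R y \<in> S"
  shows "V (a *\<^sub>R x + b *\<^sub>R y) = a *\<^sub>R V x + b *\<^sub>R V y"
proof -
  let ?z = "a *\<^sub>R x + b *\<^sub>R y"
  have "inner (V ?z - (a *\<^sub>R V x + b *\<^sub>R V y)) (V ?z - (a *\<^sub>R V x + b *\<^sub>R V y))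
      = inner (?z - (a *\<^sub>R x + b *\<^sub>R y)) (?z - (a *\<^sub>R x + b *\<^sub>R y))"
    unfolding inner_diff_left inner_diff_right
    unfolding inner_add_left[of "a *\<^sub>R V x"] inner_add_right[of _ "a *\<^sub>R V x"]
      inner_add_left[of "a *\<^sub>R x" "b *\<^sub>R y"] inner_add_right[of _ "a *\<^sub>R x" "b *\<^sub>R y"]
      inner_scaleR_left inner_scaleR_right
    by (simp add: V S inner_simps inner_commute[of y x])
  then show ?thesis by simp
qed

text \<open>The vectors on which \<open>V\<close> commutes with multiplication by \<open>\<i>\<close> and those on which it
  anticommutes form two additive subgroups covering the space; a group is not the union of two
  proper subgroups.\<close>

lemma clinear_or_conjugate_if_inner_preserving:
  fixes V :: "'a::complex_inner \<Rightarrow> 'b::complex_inner"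
  assumes add: "\<And>x y. x \<in> S \<Longrightarrow> y \<in> S \<Longrightarrow> x + y \<in> S"
    and scale: "\<And>c x. x \<in> S \<Longrightarrow> c *\<^sub>C x \<in> S"
    and V: "\<And>x y. x \<in> S \<Longrightarrow> y \<in> S \<Longrightarrow> inner (V x) (V y) = inner x y"
    and ray: "\<And>x. x \<in> S \<Longrightarrow> \<exists>c. V (\<i> *\<^sub>C x) = c *\<^sub>C V x"
  shows "(\<forall>c. \<forall>x\<in>S. V (c *\<^sub>C x) = c *\<^sub>C V x) \<or> (\<forall>c. \<forall>x\<in>S. V (c *\<^sub>C x) = cnj c *\<^sub>C V x)"
proof -
  have lin: "V (a *\<^sub>R x + b *\<^sub>R y) = a *\<^sub>R V x + b *\<^sub>R V y" if "x \<in> S" "y \<in> S" for a b x y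
    using that by (intro real_linear_if_inner_preserving[where S = S] V)
      (auto simp: scaleR_eq_scaleC intro: add scale)
  have additive: "V (x + y) = V x + V y" if "x \<in> S" "y \<in> S" for x y
    using lin[OF that, of 1 1] by simp
  have isometric: "norm (V x) = norm x" if "x \<in> S" for x
    using V[OF that that] by (simp add: norm_eq_sqrt_inner)
  have pm: "V (\<i> *\<^sub>C x) = \<i> *\<^sub>C V x \<or> V (\<i> *\<^sub>C x) = (- \<i>) *\<^sub>C V x" if x: "x \<in> S" for x
  proof (cases "x = 0")
    case True
    then have "V x = 0"
      using isometric[OF x] by simp
    with True show ?thesis by simp
  next
    case False
    obtain c where c: "V (\<i> *\<^sub>C x) = c *\<^sub>C V x"
      using ray[OF x] by blast
    have "cmod c * norm x = norm x"
      using isometric[OF scale[OF x, of \<i>]] isometric[OF x] by (simp add: c norm_scaleC)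
    then have "cmod c = 1"
      using False by simp
    have "inner (\<i> *\<^sub>C x) x = 0"
      by (simp add: inner_eq_Re_cinner cinner_simps cinner_self_eq_norm del: of_real_power)
    then have "inner (c *\<^sub>C V x) (V x) = 0"
      using V[OF scale[OF x, of \<i>] x] by (simp add: c)
    then have "Re c * (norm x)\<^sup>2 = 0"
      using isometric[OF x]
      by (simp add: inner_eq_Re_cinner cinner_simps cinner_self_eq_norm del: of_real_power)
    then have "Re c = 0"
      using False by simp
    with \<open>cmod c = 1\<close> have "\<bar>Im c\<bar> = 1"
      by (simp add: cmod_def)
    with \<open>Re c = 0\<close> have "c = \<i> \<or> c = - \<i>"
      by (auto simp: complex_eq_iff abs_if split: if_splits)
    with c show ?thesis by auto
  qed
  have minus: "(- \<i>) *\<^sub>C v = - (\<i> *\<^sub>C v)" for v :: 'b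
    using scaleC_add_left[of \<i> "- \<i>" v] by (simp add: eq_neg_iff_add_eq_0 add.commute)
  have "(\<forall>x\<in>S. V (\<i> *\<^sub>C x) = \<i> *\<^sub>C V x) \<or> (\<forall>x\<in>S. V (\<i> *\<^sub>C x) = (- \<i>) *\<^sub>C V x)"
  proof (rule ccontr)
    assume "\<not> ?thesis"
    then obtain x y where x: "x \<in> S" "V (\<i> *\<^sub>C x) \<noteq> \<i> *\<^sub>C V x" and y: "y \<in> S" "V (\<i> *\<^sub>C y) \<noteq> (- \<i>) *\<^sub>C V y"
      by blast
    have "V (\<i> *\<^sub>C x) = (- \<i>) *\<^sub>C V x" "V (\<i> *\<^sub>C y) = \<i> *\<^sub>C V y"
      using pm[OF x(1)] pm[OF y(1)] x y by auto
    then have "V (\<i> *\<^sub>C (x + y)) = (- \<i>) *\<^sub>C V x + \<i> *\<^sub>C V y"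
      using additive[OF scale scale, OF x(1) y(1), of \<i> \<i>] by (simp add: scaleC_add_right)
    moreover have "V (\<i> *\<^sub>C (x + y)) = \<i> *\<^sub>C V x + \<i> *\<^sub>C V y \<or>
        V (\<i> *\<^sub>C (x + y)) = (- \<i>) *\<^sub>C V x + (- \<i>) *\<^sub>C V y"
      using pm[OF add[OF x(1) y(1)]] by (simp add: additive x y scaleC_add_right)
    ultimately have "(- \<i>) *\<^sub>C V x = \<i> *\<^sub>C V x \<or> \<i> *\<^sub>C V y = (- \<i>) *\<^sub>C V y"
      by simp
    with x y \<open>V (\<i> *\<^sub>C x) = (- \<i>) *\<^sub>C V x\<close> \<open>V (\<i> *\<^sub>C y) = \<i> *\<^sub>C V y\<close> show False
      by simp
  qed
  moreover have "V (c *\<^sub>C x) = Re c *\<^sub>R V x + Im c *\<^sub>R V (\<i> *\<^sub>C x)" if "x \<in> S" for c x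
  proof -
    have "c *\<^sub>C x = Re c *\<^sub>R x + Im c *\<^sub>R (\<i> *\<^sub>C x)"
      by (subst complex_eq[of c])
        (simp add: scaleR_eq_scaleC scaleC_scaleC scaleC_add_left mult.commute)
    then show ?thesis
      using lin that scale by simp
  qed
  moreover have "Re c *\<^sub>R v + Im c *\<^sub>R (\<i> *\<^sub>C v) = c *\<^sub>C v" for c and v :: 'b
    by (subst (3) complex_eq[of c])
      (simp add: scaleR_eq_scaleC scaleC_scaleC scaleC_add_left mult.commute)
  moreover have "Re c *\<^sub>R v + Im c *\<^sub>R ((- \<i>) *\<^sub>C v) = cnj c *\<^sub>C v" for c and v :: 'b
    using calculation(3)[of "cnj c" v] by (simp add: minus)
  ultimately show ?thesis
    by metis
qed

text \<open>To construct \<open>V\<close>, normalise the phase of \<open>T (e + x)\<close>, for \<open>x\<close> orthogonal to \<open>e\<close>, so that its component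
  along \<open>T e\<close> is \<open>T e\<close> itself; the remaining component is \<open>V x\<close>. Transition probabilities between the
  vectors \<open>e + x\<close> yield \<open>\<bar>1 + \<langle>V x, V y\<rangle>\<bar> = \<bar>1 + \<langle>x, y\<rangle>\<bar>\<close>, and those between
  the vectors \<open>x\<close> yield \<open>\<bar>\<langle>V x, V y\<rangle>\<bar> = \<bar>\<langle>x, y\<rangle>\<bar>\<close>; together they determine the real
  part.\<close>

lemma phase_normalised_complement_map:
  fixes T :: "'a::complex_inner \<Rightarrow> 'b::complex_inner"
  assumes T: "\<And>x y. cmod (cinner (T x) (T y)) = cmod (cinner x y)" and e: "norm e = 1"
  shows "\<exists>V. (\<forall>x. cinner x e = 0 \<longrightarrow> cinner (V x) (T e) = 0 \<and>
        (\<exists>c. cmod c = 1 \<and> T e + V x = c *\<^sub>C T (e + x)) \<and> (\<exists>c. cmod c = 1 \<and> V x = c *\<^sub>C T x)) \<and>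
      (\<forall>x y. cinner x e = 0 \<longrightarrow> cinner y e = 0 \<longrightarrow> inner (V x) (V y) = inner x y)"
proof -
  define e' where "e' = T e"
  have normT: "norm (T x) = norm x" for x
    using T[of x x] by (simp add: cmod_cinner_self power2_eq_iff_nonneg)
  have ee: "cinner e e = 1" and ee': "cinner e' e' = 1"
    using e normT[of e] by (simp_all add: cinner_self_eq_norm e'_def)
  define k where "k x = inverse (cinner (T (e + x)) e')" for x
  define V where "V x = k x *\<^sub>C T (e + x) - e'" for x
  have k: "cmod (k x) = 1" and kx: "k x * cinner (T (e + x)) e' = 1" if "cinner x e = 0" for x
  proof -
    have "cmod (cinner (T (e + x)) e') = 1"
      using that by (simp add: e'_def T cinner_simps ee)
    moreover from this have "cinner (T (e + x)) e' \<noteq> 0"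
      by auto
    ultimately show "cmod (k x) = 1" "k x * cinner (T (e + x)) e' = 1"
      by (simp_all add: k_def norm_inverse)
  qed
  have eV: "e' + V x = k x *\<^sub>C T (e + x)" for x
    by (simp add: V_def)
  have orth: "cinner (V x) e' = 0" if "cinner x e = 0" for x
    using kx[OF that] by (simp add: V_def cinner_simps ee')
  have orth': "cinner e' (V x) = 0" if "cinner x e = 0" for x
    using orth[OF that] cinner_commute[of e' "V x"] by simp
  have orthe: "cinner e x = 0" if "cinner x e = 0" for x
    using that cinner_commute[of e x] by simp
  have plus1: "cmod (1 + cinner (V x) (V y)) = cmod (1 + cinner x y)"
    if "cinner x e = 0" "cinner y e = 0" for x y
  proof -
    have "cmod (cinner (e' + V x) (e' + V y)) = cmod (cinner (e + x) (e + y))"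
      unfolding eV using that by (simp add: cinner_simps norm_mult k T flip: cinner_add_left cinner_add_right)
    then show ?thesis
      using that by (simp add: cinner_simps ee ee' orth orth' orthe)
  qed
  have normV: "norm (V x) = norm x" if "cinner x e = 0" for x
  proof -
    have "cmod (1 + of_real (r\<^sup>2)) = 1 + r\<^sup>2" for r :: real
      using norm_of_real[of "1 + r\<^sup>2", where 'a = complex] by simp
    then have "1 + (norm (V x))\<^sup>2 = 1 + (norm x)\<^sup>2"
      using plus1[OF that that] by (simp only: cinner_self_eq_norm)
    then show ?thesis
      by (simp add: power2_eq_iff_nonneg)
  qed
  have ray: "\<exists>c. cmod c = 1 \<and> V x = c *\<^sub>C T x" if x: "cinner x e = 0" for x
  proof (rule phase_multiple_if_cmod_cinner_eq)
    show "norm (V x) = norm (T x)"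
      by (simp add: normV[OF x] normT)
    have "cmod (cinner e' (T x)) = 0"
      using orthe[OF x] by (simp add: e'_def T)
    then have "cmod (cinner (V x) (T x)) = cmod (cinner (e' + V x) (T x))"
      by (simp add: cinner_add_left)
    also have "\<dots> = cmod (cinner (e + x) x)"
      by (simp add: eV cinner_scaleC_left norm_mult k[OF x] T)
    also have "\<dots> = (norm (T x))\<^sup>2"
      by (simp add: cinner_add_left orthe[OF x] cmod_cinner_self normT)
    finally show "cmod (cinner (V x) (T x)) = (norm (T x))\<^sup>2" .
  qed
  have re: "inner (V x) (V y) = inner x y" if x: "cinner x e = 0" and y: "cinner y e = 0" for x y
  proof -
    obtain c d where "cmod c = 1" "V x = c *\<^sub>C T x" "cmod d = 1" "V y = d *\<^sub>C T y"
      using ray[OF x] ray[OF y] by blast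
    then have "cmod (cinner (V x) (V y)) = cmod (cinner x y)"
      by (simp add: cinner_simps norm_mult T)
    moreover have "(cmod (1 + z))\<^sup>2 = 1 + 2 * Re z + (cmod z)\<^sup>2" for z
      unfolding cmod_power2 by (simp add: power2_eq_square algebra_simps)
    ultimately show ?thesis
      using plus1[OF x y] by (metis add_left_cancel add_right_cancel inner_eq_Re_cinner
          mult_cancel_left zero_neq_numeral)
  qed
  show ?thesis
    by (rule exI[of _ V]) (use orth ray re k eV in \<open>unfold e'_def, blast\<close>)
qed

text \<open>Wigner's theorem: extend the map \<open>V\<close> on the orthogonal complement of \<open>e\<close> by \<open>e \<mapsto> T e\<close>,
  linearly or conjugate-linearly, whichever \<open>V\<close> is.  Since \<open>a e + x = a (e + x / a)\<close>, every vector
  keeps the ray that \<open>T\<close> assigns to it.\<close>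

theorem Wigner:
  fixes T :: "'a::complex_inner \<Rightarrow> 'b::complex_inner"
  assumes T: "\<And>x y. cmod (cinner (T x) (T y)) = cmod (cinner x y)" and e: "norm e = 1"
  obtains U where "\<And>x y. U (x + y) = U x + U y"
    and "(\<forall>c x. U (c *\<^sub>C x) = c *\<^sub>C U x) \<or> (\<forall>c x. U (c *\<^sub>C x) = cnj c *\<^sub>C U x)"
    and "\<And>x. \<exists>c. cmod c = 1 \<and> U x = c *\<^sub>C T x" and "U e = T e"
proof -
  obtain V where orth: "\<And>x. cinner x e = 0 \<Longrightarrow> cinner (V x) (T e) = 0"
    and eV: "\<And>x. cinner x e = 0 \<Longrightarrow> \<exists>c. cmod c = 1 \<and> T e + V x = c *\<^sub>C T (e + x)"
    and ray: "\<And>x. cinner x e = 0 \<Longrightarrow> \<exists>c. cmod c = 1 \<and> V x = c *\<^sub>C T x"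
    and V: "\<And>x y. cinner x e = 0 \<Longrightarrow> cinner y e = 0 \<Longrightarrow> inner (V x) (V y) = inner x y"
    using phase_normalised_complement_map[OF T e] by blast
  have ee: "cinner e e = 1"
    using e by (simp add: cinner_self_eq_norm)
  have normT: "norm (T x) = norm x" for x
    using T[of x x] by (simp add: cmod_cinner_self power2_eq_iff_nonneg)
  have T_scale: "\<exists>d. cmod d = 1 \<and> c *\<^sub>C T x = d *\<^sub>C T (c *\<^sub>C x)" for c x
    by (rule phase_multiple_if_cmod_cinner_eq)
      (simp_all add: norm_scaleC normT cinner_simps norm_mult T cmod_cinner_self power_mult_distrib
        power2_eq_square mult_ac)
  have V_add: "V (x + y) = V x + V y" if "cinner x e = 0" "cinner y e = 0" for x y
    using real_linear_if_inner_preserving[of "{x. cinner x e = 0}" V x y 1 1] V that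
    by (simp add: cinner_simps)
  have V_i: "\<exists>c. V (\<i> *\<^sub>C x) = c *\<^sub>C V x" if x: "cinner x e = 0" for x
  proof -
    obtain c where c: "cmod c = 1" "V x = c *\<^sub>C T x"
      using ray[OF x] by blast
    obtain d where d: "V (\<i> *\<^sub>C x) = d *\<^sub>C T (\<i> *\<^sub>C x)"
      using ray[of "\<i> *\<^sub>C x"] x by (auto simp: cinner_simps)
    obtain f where f: "cmod f = 1" "\<i> *\<^sub>C T x = f *\<^sub>C T (\<i> *\<^sub>C x)"
      using T_scale by blast
    have "f \<noteq> 0" "c \<noteq> 0"
      using f c by auto
    have "T (\<i> *\<^sub>C x) = inverse f *\<^sub>C f *\<^sub>C T (\<i> *\<^sub>C x)"
      using \<open>f \<noteq> 0\<close> by (simp add: scaleC_scaleC)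
    then have "T (\<i> *\<^sub>C x) = inverse f *\<^sub>C \<i> *\<^sub>C T x"
      by (simp only: f(2))
    moreover have "T x = inverse c *\<^sub>C V x"
      using \<open>c \<noteq> 0\<close> by (simp add: c(2) scaleC_scaleC)
    ultimately show ?thesis
      using d by (metis scaleC_scaleC)
  qed
  have "(\<forall>c. \<forall>x\<in>{x. cinner x e = 0}. V (c *\<^sub>C x) = c *\<^sub>C V x) \<or>
      (\<forall>c. \<forall>x\<in>{x. cinner x e = 0}. V (c *\<^sub>C x) = cnj c *\<^sub>C V x)"
    by (rule clinear_or_conjugate_if_inner_preserving) (auto simp: cinner_simps V V_i)
  then obtain \<tau> where \<tau>: "\<tau> = (\<lambda>c. c) \<or> \<tau> = cnj"
    and V_scale: "\<And>c x. cinner x e = 0 \<Longrightarrow> V (c *\<^sub>C x) = \<tau> c *\<^sub>C V x"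
    by (smt (verit, best) mem_Collect_eq)
  have \<tau>_simps: "\<tau> (a + b) = \<tau> a + \<tau> b" "\<tau> (a * b) = \<tau> a * \<tau> b" "\<tau> 0 = 0" "\<tau> 1 = 1"
    "cmod (\<tau> a) = cmod a" for a b
    using \<tau> by auto
  define U where "U z = \<tau> (cinner z e) *\<^sub>C T e + V (z - cinner z e *\<^sub>C e)" for z
  have perp: "cinner (z - cinner z e *\<^sub>C e) e = 0" for z
    by (simp add: cinner_simps ee)
  have V0: "V 0 = 0"
    using V[of 0 0] by simp
  show thesis
  proof (rule that)
    show "U (x + y) = U x + U y" for x y
    proof -
      have "x + y - cinner (x + y) e *\<^sub>C e = (x - cinner x e *\<^sub>C e) + (y - cinner y e *\<^sub>C e)"
        by (simp add: cinner_simps scaleC_add_left)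
      then have "V (x + y - cinner (x + y) e *\<^sub>C e) = V (x - cinner x e *\<^sub>C e) + V (y - cinner y e *\<^sub>C e)"
        by (simp only: V_add[OF perp perp])
      then show ?thesis
        by (simp add: U_def cinner_add_left \<tau>_simps scaleC_add_left)
    qed
    have U_scale: "U (c *\<^sub>C x) = \<tau> c *\<^sub>C U x" for c x
    proof -
      have "c *\<^sub>C x - cinner (c *\<^sub>C x) e *\<^sub>C e = c *\<^sub>C (x - cinner x e *\<^sub>C e)"
        by (simp add: cinner_simps scaleC_diff_right scaleC_scaleC)
      then have "V (c *\<^sub>C x - cinner (c *\<^sub>C x) e *\<^sub>C e) = \<tau> c *\<^sub>C V (x - cinner x e *\<^sub>C e)"
        by (simp only: V_scale[OF perp])
      then show ?thesis
        by (simp add: U_def cinner_scaleC_left \<tau>_simps scaleC_add_right scaleC_scaleC)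
    qed
    then show "(\<forall>c x. U (c *\<^sub>C x) = c *\<^sub>C U x) \<or> (\<forall>c x. U (c *\<^sub>C x) = cnj c *\<^sub>C U x)"
      using \<tau> by auto
    show "U e = T e"
      by (simp add: U_def ee \<tau>_simps V0)
    show "\<exists>c. cmod c = 1 \<and> U z = c *\<^sub>C T z" for z
    proof (cases "cinner z e = 0")
      case True
      then show ?thesis
        using ray[of z] by (simp add: U_def \<tau>_simps)
    next
      case False
      define a where "a = cinner z e"
      define x where "x = inverse a *\<^sub>C (z - a *\<^sub>C e)"
      have x: "cinner x e = 0"
        using perp[of z] by (simp add: x_def a_def cinner_scaleC_left)
      have z: "z = a *\<^sub>C (e + x)"
        using False by (simp add: x_def a_def scaleC_add_right scaleC_scaleC)
      have "U (e + x) = T e + V x"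
        using x by (simp add: U_def cinner_add_left ee \<tau>_simps)
      then obtain c where c: "cmod c = 1" "U (e + x) = c *\<^sub>C T (e + x)"
        using eV[OF x] by auto
      obtain d where d: "cmod d = 1" "a *\<^sub>C T (e + x) = d *\<^sub>C T z"
        using T_scale[of a "e + x"] z by auto
      \<comment> \<open>Conjugation may change \<open>a\<close>, but only by the phase \<open>\<tau> a / a\<close>.\<close>
      define k where "k = \<tau> a / a * c * d"
      have "a \<noteq> 0"
        using False by (simp add: a_def)
      have "U z = \<tau> a *\<^sub>C c *\<^sub>C T (e + x)"
        by (simp add: z U_scale c)
      also have "\<dots> = (\<tau> a / a * c) *\<^sub>C a *\<^sub>C T (e + x)"
        using \<open>a \<noteq> 0\<close> by (simp add: scaleC_scaleC)
      also have "\<dots> = k *\<^sub>C T z"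
        by (simp only: d(2) scaleC_scaleC k_def)
      finally show ?thesis
        using \<open>a \<noteq> 0\<close> c(1) d(1) by (intro exI[of _ k]) (simp add: k_def norm_mult norm_divide \<tau>_simps)
    qed
  qed
qed

section \<open>Order automorphisms are implemented by unitary or antiunitary operators\<close>

lemma norm_eq_inner_preserving:
  fixes U :: "'a::real_inner \<Rightarrow> 'b::real_inner"
  assumes "\<And>x y. U (x + y) = U x + U y" "\<And>x. norm (U x) = norm x"
  shows "inner (U x) (U y) = inner x y"
  using assms(2)[of "x + y"] by (simp add: dot_norm assms)

context state_order_automorphism
begin

lemma state_vector_image: "\<phi> (rank1 \<xi>) = rank1 \<psi>"
proof -
  obtain y where y: "norm y = 1" "\<phi> (rank1 \<xi>) = rank1 y"
    using maps_rank1_unit unit by blast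
  have "cmod (cinner \<psi> y) = 1"
    using rank1_state[of \<xi> y] y unit by (simp add: cmod_cinner_self)
  then obtain c where "cmod c = 1" "\<psi> = c *\<^sub>C y"
    using phase_multiple_if_cmod_cinner_eq[of \<psi> y] y unit by auto
  with y show ?thesis
    by (simp add: rank1_phase)
qed

text \<open>A choice of representatives for the map on lines, made homogeneous for the norm.  Among the
  representatives for \<open>\<xi>\<close> the vector \<open>\<psi>\<close> is chosen, so that the operator obtained from Wigner's
  theorem maps \<open>\<xi>\<close> to \<open>\<psi>\<close> exactly.\<close>

lemma vector_map:
  obtains T where "\<And>x. norm (T x) = norm x" "\<And>x. \<phi> (rank1 (sgn x)) = rank1 (sgn (T x))"
    "\<And>x y. cmod (cinner (T x) (T y)) = cmod (cinner x y)" "T \<xi> = \<psi>"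
proof -
  have "\<exists>y. norm y = norm x \<and> (x \<noteq> 0 \<longrightarrow> \<phi> (rank1 (sgn x)) = rank1 (sgn y)) \<and> (x = \<xi> \<longrightarrow> y = \<psi>)" for x
  proof (cases "x = \<xi>")
    case True
    then show ?thesis
      using unit state_vector_image by (intro exI[of _ \<psi>]) (simp add: sgn_div_norm)
  next
    case False
    show ?thesis
    proof (cases "x = 0")
      case True
      with False show ?thesis by simp
    next
      case x: False
      then obtain y where y: "norm y = 1" "\<phi> (rank1 (sgn x)) = rank1 y"
        using maps_rank1_unit[of "sgn x"] by (auto simp: norm_sgn)
      then show ?thesis
        using x False by (intro exI[of _ "norm x *\<^sub>R y"]) (simp add: sgn_div_norm)
    qed
  qed
  then obtain T where T: "\<And>x. norm (T x) = norm x" "T \<xi> = \<psi>"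
    "\<And>x. x \<noteq> 0 \<Longrightarrow> \<phi> (rank1 (sgn x)) = rank1 (sgn (T x))"
    by metis
  have expand: "cmod (cinner x y) = norm x * norm y * cmod (cinner (sgn x) (sgn y))" for x y :: 'a
    by (cases "x = 0 \<or> y = 0") (auto simp: sgn_div_norm cinner_simps norm_mult norm_inverse norm_divide field_simps)
  have T0: "T 0 = 0"
    using T(1)[of 0] by simp
  have "cmod (cinner (T x) (T y)) = cmod (cinner x y)" for x y
  proof (cases "x = 0 \<or> y = 0")
    case True
    then show ?thesis
      by (auto simp: T0)
  next
    case False
    then have "T x \<noteq> 0" "T y \<noteq> 0"
      using T(1)[of x] T(1)[of y] by auto
    then have "cmod (cinner (sgn (T x)) (sgn (T y))) = cmod (cinner (sgn x) (sgn y))"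
      using False by (intro preserves_transition_probability T) (simp_all add: norm_sgn)
    then show ?thesis
      using expand[of x y] expand[of "T x" "T y"] by (simp add: T)
  qed
  moreover have "\<phi> (rank1 0) = rank1 0"
  proof -
    have "\<phi> (\<lambda>x. 0) = (\<lambda>x. 0)"
      using maps_scalar[of 0] by simp
    then show ?thesis
      by (simp add: rank1_0)
  qed
  ultimately show thesis
    using T T0 by (intro that[of T]) (metis sgn_zero)+
qed

theorem implemented_by_unitary_or_antiunitary:
  "\<exists>U. (unitary_op U \<or> antiunitary_op U) \<and> (\<forall>E\<in>effects. \<phi> E = U \<circ> E \<circ> inv U) \<and> U \<xi> = \<psi>"
proof -
  obtain T where T: "\<And>x. norm (T x) = norm x" "\<And>x. \<phi> (rank1 (sgn x)) = rank1 (sgn (T x))"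
    "\<And>x y. cmod (cinner (T x) (T y)) = cmod (cinner x y)" "T \<xi> = \<psi>"
    using vector_map by blast
  obtain U where U_add: "\<And>x y. U (x + y) = U x + U y"
    and U_scale: "(\<forall>c x. U (c *\<^sub>C x) = c *\<^sub>C U x) \<or> (\<forall>c x. U (c *\<^sub>C x) = cnj c *\<^sub>C U x)"
    and U_ray: "\<And>x. \<exists>c. cmod c = 1 \<and> U x = c *\<^sub>C T x" and U\<xi>: "U \<xi> = T \<xi>"
    using Wigner[OF T(3) unit(1)] by blast
  have U_norm: "norm (U x) = norm x" for x
    using U_ray[of x] T(1)[of x] by (auto simp: norm_scaleC)
  have U_inner: "inner (U x) (U y) = inner x y" for x y
    by (rule norm_eq_inner_preserving[OF U_add U_norm])
  have U_cmod: "cmod (cinner (U x) (U y)) = cmod (cinner x y)" for x y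
  proof -
    obtain c d where "cmod c = 1" "U x = c *\<^sub>C T x" "cmod d = 1" "U y = d *\<^sub>C T y"
      using U_ray by metis
    then show ?thesis
      by (simp add: cinner_simps norm_mult T)
  qed
  have U_sgn: "\<phi> (rank1 (sgn x)) = rank1 (sgn (U x))" for x
  proof -
    obtain c where c: "cmod c = 1" "U x = c *\<^sub>C T x"
      using U_ray by blast
    then have "sgn (U x) = c *\<^sub>C sgn (T x)"
      by (simp add: sgn_div_norm norm_scaleC scaleR_eq_scaleC scaleC_scaleC mult.commute)
    then show ?thesis
      by (simp add: T(2) rank1_phase c)
  qed
  have U_rank1: "\<phi> (rank1 y) = rank1 (U y)" if y: "norm y \<le> 1" for y
  proof (cases "y = 0")
    case True
    then show ?thesis
      using U_sgn[of 0] U_norm[of 0] by simp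
  next
    case False
    then have "U y \<noteq> 0"
      using U_norm[of y] by auto
    then have "\<phi> (rank1 (norm y *\<^sub>R sgn y)) = rank1 (norm y *\<^sub>R sgn (U y))"
      using False y by (intro maps_rank1_scaleR U_sgn) (simp_all add: norm_sgn)
    moreover have "norm y *\<^sub>R sgn y = y" "norm y *\<^sub>R sgn (U y) = U y"
      using False \<open>U y \<noteq> 0\<close> U_norm[of y] by (simp_all add: sgn_div_norm)
    ultimately show ?thesis
      by simp
  qed
  have U_range: "c *\<^sub>C U x \<in> range U" for c x
    using U_scale by (metis complex_cnj_cnj rangeI)
  have "surj U"
    unfolding surj_def
  proof
    fix y
    have "\<exists>x. U x = y"
    proof (cases "y = 0")
      case True
      then show ?thesis
        using U_norm[of 0] by (intro exI[of _ 0]) simp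
    next
      case False
      then obtain x where x: "norm x = 1" "\<phi> (rank1 x) = rank1 (sgn y)"
        using rank1_unit_preimage[of "sgn y"] by (auto simp: norm_sgn)
      then have "rank1 (sgn y) = rank1 (U x)"
        by (simp add: U_rank1)
      then obtain c where "sgn y = c *\<^sub>C U x"
        using rank1_eq_imp_phase[of "sgn y" "U x"] False x by (auto simp: norm_sgn U_norm)
      then have "y = norm y *\<^sub>R c *\<^sub>C U x"
        using False by (metis norm_sgn scaleR_one sgn_div_norm norm_eq_zero scaleR_scaleR right_inverse)
      then have "y = (of_real (norm y) * c) *\<^sub>C U x"
        by (simp add: scaleR_eq_scaleC scaleC_scaleC)
      then show ?thesis
        using U_range by (metis rangeE)
    qed
    then show "\<exists>x. y = U x"
      by metis
  qed
  then have UinvU: "U (inv U x) = x" for x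
    by (rule surj_f_inv_f)
  \<comment> \<open>Rank-one effects touching one side at \<open>z\<close> or \<open>U z\<close> are carried to rank-one effects below
    the other side.\<close>
  have form: "inner (\<phi> E (U z)) (U z) = inner (E z) z" if E: "E \<in> effects" for E z
  proof (rule antisym)
    obtain v where v: "norm v \<le> 1" "rank1 v \<le>\<^sub>o\<^sub>p \<phi> E" "(cmod (cinner (U z) v))\<^sup>2 = inner (\<phi> E (U z)) (U z)"
      using rank1_below_effect_touching[OF maps_effects[OF E]] by metis
    define y where "y = inv U v"
    have y: "U y = v" "norm y \<le> 1"
      using v(1) U_norm[of y] by (simp_all add: y_def UinvU)
    have "rank1 y \<le>\<^sub>o\<^sub>p E"
      using order[of "rank1 y" E] v y E by (simp add: rank1_in_effects_iff U_rank1)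
    then have "(cmod (cinner z y))\<^sup>2 \<le> inner (E z) z"
      using rank1_le_iff y E by blast
    then show "inner (\<phi> E (U z)) (U z) \<le> inner (E z) z"
      using v(3) U_cmod[of z y] y by simp
  next
    obtain v where v: "norm v \<le> 1" "rank1 v \<le>\<^sub>o\<^sub>p E" "(cmod (cinner z v))\<^sup>2 = inner (E z) z"
      using rank1_below_effect_touching[OF E] by metis
    have "rank1 (U v) \<le>\<^sub>o\<^sub>p \<phi> E"
      using order[of "rank1 v" E] v E by (simp add: rank1_in_effects_iff U_rank1)
    then have "(cmod (cinner (U z) (U v)))\<^sup>2 \<le> inner (\<phi> E (U z)) (U z)"
      using rank1_le_iff[of "U v" "\<phi> E"] v maps_effects[OF E] U_norm[of v] by simp
    then show "inner (E z) z \<le> inner (\<phi> E (U z)) (U z)"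
      using v(3) by (simp add: U_cmod)
  qed
  have inv_add: "inv U (x + y) = inv U x + inv U y" for x y
  proof (rule injD)
    show "inj U"
    proof (rule injI)
      fix x y
      assume "U x = U y"
      then have "inner (U x - U y) (U x - U y) = 0"
        by simp
      moreover have "inner (x - y) (x - y) = inner (U x - U y) (U x - U y)"
        by (simp add: inner_simps U_inner)
      ultimately have "inner (x - y) (x - y) = 0"
        by simp
      then show "x = y" by simp
    qed
  qed (simp add: UinvU U_add)
  have "\<phi> E = U \<circ> E \<circ> inv U" if E: "E \<in> effects" for E
  proof (rule quadratic_form_eq_imp_eq)
    show "inner (\<phi> E x) x = inner ((U \<circ> E \<circ> inv U) x) x" for x
      using form[OF E, of "inv U x"] U_inner[of "E (inv U x)" "inv U x"] by (simp add: UinvU)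
    show "inner ((U \<circ> E \<circ> inv U) x) y = inner x ((U \<circ> E \<circ> inv U) y)" for x y
      using U_inner[of "E (inv U x)" "inv U y"] U_inner[of "inv U x" "E (inv U y)"]
        effect_inner[OF E, of "inv U x" "inv U y"] by (simp add: UinvU)
  qed (simp_all add: effect_add[OF E] effect_add[OF maps_effects[OF E]]
      effect_inner[OF maps_effects[OF E]] inv_add U_add)
  moreover have "unitary_op U \<or> antiunitary_op U"
    using U_add U_scale U_norm \<open>surj U\<close> unfolding unitary_op_def antiunitary_op_def by blast
  ultimately show ?thesis
    using U\<xi> T(4) by auto
qed

end

theorem theorem2:
  fixes \<phi> :: "('a::complex_hilbert \<Rightarrow> 'a) \<Rightarrow> ('a \<Rightarrow> 'a)"
    and \<xi> \<psi> :: 'a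
  assumes "cdim_at_least 3 TYPE('a)"
    and "bij_betw \<phi> effects effects"
    and "\<And>E F. E \<in> effects \<Longrightarrow> F \<in> effects \<Longrightarrow> E \<le>\<^sub>o\<^sub>p F \<longleftrightarrow> \<phi> E \<le>\<^sub>o\<^sub>p \<phi> F"
    and "norm \<xi> = 1" and "norm \<psi> = 1"
    and "\<And>E. E \<in> effects \<Longrightarrow> cinner (\<phi> E \<psi>) \<psi> = cinner (E \<xi>) \<xi>"
  shows "\<exists>U. (unitary_op U \<or> antiunitary_op U) \<and>
    (\<forall>E\<in>effects. \<phi> E = U \<circ> E \<circ> inv U) \<and> U \<xi> = \<psi>"
proof -
  interpret state_order_automorphism \<phi> \<xi> \<psi>
    by unfold_locales (use assms in \<open>simp_all add: inner_eq_Re_cinner\<close>)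
  show ?thesis
    by (rule implemented_by_unitary_or_antiunitary)
qed

end
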